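(* Let $A$ be a semisimple and commutative unital (associative) complex Banach algebra with unit $\mathbf{1}_A$, and let $N$ be a unital complex Jordan--Banach algebra. Let $\mathfrak{A}\subseteq A^{-1}$ and $\mathfrak{N}\subseteq N^{-1}$ be clopen quadratic subsets (clopen relative to $A^{-1}$ and $N^{-1}$, respectively) which are closed for powers and inverses. Let $\Delta:\mathfrak{A}\to\mathfrak{N}$ be a surjective isometry for the distances given by the norms of $A$ and $N$, respectively. Then $N$ is semisimple and associative, and the mapping $\Delta(\mathbf{1}_A)^{-1}\Delta$ (that is, $a\mapsto \Delta(\mathbf{1}_A)^{-1}\circ\Delta(a)$) admits an extension to an isometric real-linear algebra isomorphism from $A$ onto $N$. In particular, $A^{-1}$ and $N^{-1}$ are isometrically isomorphic as metric groups.
   Context: A complex Jordan algebra is a complex vector space $M$ with a commutative bilinear product $\circ$ satisfying $(a\circ b)\circ a^2=a\circ(b\circ a^2)$. A Jordan--Banach algebra is a Jordan algebra with a complete norm satisfying $\|a\circ b\|\le\|a\|\,\|b\|$; if it is unital one also requires $\|\mathbf{1}\|=1$ (likewise for unital Banach algebras). Every Banach algebra is a Jordan--Banach algebra with $a\circ b=\frac12(ab+ba)$. Write $U_a(x)=2(a\circ x)\circ a-a^2\circ x$. An element $a$ of a unital Jordan--Banach algebra $M$ is invertible if there is a (necessarily unique) $b=a^{-1}\in M$ with $a\circ b=\mathbf{1}$ and $a^2\circ b=a$; for Banach algebras this agrees with the usual notion. $M^{-1}$ denotes the set of invertible elements. A subset $\mathfrak{M}\subseteq M^{-1}$ is a quadratic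 subset if it is non-empty and $U_a(b)\in\mathfrak{M}$ for all $a,b\in\mathfrak{M}$. It is closed for powers and inverses if $a^n\in\mathfrak{M}$ (for $n\in\mathbb{N}$) and $a^{-1}\in\mathfrak{M}$ whenever $a\in\mathfrak{M}$. An element $a$ of a unital Jordan--Banach algebra is quasi-invertible if $\mathbf{1}-a$ is invertible. An ideal is a subspace $J$ with $U_M(J)\subseteq J$, $U_J(M)\subseteq J$ and $J^2\subseteq J$. The McCrimmon radical of a Jordan--Banach algebra is its largest ideal consisting of quasi-invertible elements (it exists); the algebra is semisimple if this radical is $\{0\}$. For Banach algebras it coincides with the Jacobson radical. *)

theory Defs
  imports "HOL-Analysis.Analysis" "HOL-Algebra.Group"
begin

class complex_banach = banach +
  fixes scaleC :: "complex \<Rightarrow> 'a \<Rightarrow> 'a"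
  assumes scaleC_add_right: "scaleC c (x + y) = scaleC c x + scaleC c y"
    and scaleC_add_left: "scaleC (c + d) x = scaleC c x + scaleC d x"
    and scaleC_scaleC: "scaleC c (scaleC d x) = scaleC (c * d) x"
    and scaleC_of_real: "scaleC (complex_of_real r) x = r *\<^sub>R x"
    and norm_scaleC: "norm (scaleC c x) = cmod c * norm x"

text \<open>The class \<open>real_normed_algebra_1\<close> supplies submultiplicativity of the norm and
  \<open>norm 1 = 1\<close>.\<close>

class complex_banach_algebra_1 = complex_banach + real_normed_algebra_1 +
  assumes mult_scaleC_left: "scaleC c x * y = scaleC c (x * y)"
    and mult_scaleC_right: "x * scaleC c y = scaleC c (x * y)"

instantiation complex :: complex_banach_algebra_1
begin
definition scaleC_complex :: "complex \<Rightarrow> complex \<Rightarrow> complex"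
  where "scaleC_complex c x = c * x"
instance
  by standard (auto simp: scaleC_complex_def algebra_simps norm_mult scaleR_conv_of_real)
end

text \<open>The Jordan product \<open>jp\<close> and the unit \<open>e\<close> are explicit parameters, so that a Banach algebra
  can be regarded as a Jordan--Banach algebra for its symmetrised product without a second type.\<close>

locale unital_jordan_banach_algebra =
  fixes jp :: "'a::complex_banach \<Rightarrow> 'a \<Rightarrow> 'a" and e :: 'a
  assumes jp_commute: "jp a b = jp b a"
    and jp_add_left: "jp (a + b) c = jp a c + jp b c"
    and jp_scaleC_left: "jp (scaleC k a) b = scaleC k (jp a b)"
    and jordan_identity: "jp (jp a b) (jp a a) = jp a (jp b (jp a a))"
    and norm_jp: "norm (jp a b) \<le> norm a * norm b"
    and jp_unit: "jp e a = a"
    and norm_unit: "norm e = 1"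

definition special_jp :: "'a::real_algebra \<Rightarrow> 'a \<Rightarrow> 'a"
  where "special_jp a b = (1/2) *\<^sub>R (a * b + b * a)"

definition U_op :: "('a \<Rightarrow> 'a \<Rightarrow> 'a) \<Rightarrow> 'a::real_vector \<Rightarrow> 'a \<Rightarrow> 'a"
  where "U_op jp a x = 2 *\<^sub>R jp (jp a x) a - jp (jp a a) x"

definition is_jinverse :: "('a \<Rightarrow> 'a \<Rightarrow> 'a) \<Rightarrow> 'a \<Rightarrow> 'a \<Rightarrow> 'a \<Rightarrow> bool"
  where "is_jinverse jp e a b \<longleftrightarrow> jp a b = e \<and> jp (jp a a) b = a"

definition invertibles :: "('a \<Rightarrow> 'a \<Rightarrow> 'a) \<Rightarrow> 'a \<Rightarrow> 'a set"
  where "invertibles jp e = {a. \<exists>b. is_jinverse jp e a b}"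

definition jinverse :: "('a \<Rightarrow> 'a \<Rightarrow> 'a) \<Rightarrow> 'a \<Rightarrow> 'a \<Rightarrow> 'a"
  where "jinverse jp e a = (THE b. is_jinverse jp e a b)"

primrec jpower :: "('a \<Rightarrow> 'a \<Rightarrow> 'a) \<Rightarrow> 'a \<Rightarrow> 'a \<Rightarrow> nat \<Rightarrow> 'a" where
  "jpower jp e a 0 = e"
| "jpower jp e a (Suc n) = jp a (jpower jp e a n)"

definition quadratic_subset :: "('a \<Rightarrow> 'a \<Rightarrow> 'a) \<Rightarrow> 'a \<Rightarrow> 'a::real_vector set \<Rightarrow> bool"
  where "quadratic_subset jp e M \<longleftrightarrow>
    M \<subseteq> invertibles jp e \<and> M \<noteq> {} \<and> (\<forall>a\<in>M. \<forall>b\<in>M. U_op jp a b \<in> M)"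

text \<open>Including \<open>n = 0\<close> below would change nothing for a quadratic subset \<open>M\<close>:
  if \<open>a \<in> M\<close> and \<open>b = jinverse a\<close>, then \<open>e = U a (b\<^sup>2)\<close> belongs to \<open>M\<close>.\<close>

definition closed_powers_inverses :: "('a \<Rightarrow> 'a \<Rightarrow> 'a) \<Rightarrow> 'a \<Rightarrow> 'a set \<Rightarrow> bool"
  where "closed_powers_inverses jp e M \<longleftrightarrow>
    (\<forall>a\<in>M. (\<forall>n\<ge>1. jpower jp e a n \<in> M) \<and> jinverse jp e a \<in> M)"

definition clopen_in :: "'a::topological_space set \<Rightarrow> 'a set \<Rightarrow> bool"
  where "clopen_in X M \<longleftrightarrow> openin (top_of_set X) M \<and> closedin (top_of_set X) M"

definition complex_subspace :: "'a::complex_banach set \<Rightarrow> bool"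
  where "complex_subspace J \<longleftrightarrow>
    0 \<in> J \<and> (\<forall>x\<in>J. \<forall>y\<in>J. x + y \<in> J) \<and> (\<forall>c. \<forall>x\<in>J. scaleC c x \<in> J)"

definition jordan_ideal :: "('a \<Rightarrow> 'a \<Rightarrow> 'a) \<Rightarrow> 'a::complex_banach set \<Rightarrow> bool"
  where "jordan_ideal jp J \<longleftrightarrow> complex_subspace J \<and>
    (\<forall>a. \<forall>x\<in>J. U_op jp a x \<in> J) \<and> (\<forall>x\<in>J. \<forall>a. U_op jp x a \<in> J) \<and> (\<forall>x\<in>J. jp x x \<in> J)"

definition quasi_invertible :: "('a \<Rightarrow> 'a \<Rightarrow> 'a) \<Rightarrow> 'a::real_vector \<Rightarrow> 'a \<Rightarrow> bool"
  where "quasi_invertible jp e a \<longleftrightarrow> e - a \<in> invertibles jp e"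

text \<open>The order on sets is inclusion, so this is the largest such ideal.\<close>

definition mccrimmon_radical :: "('a \<Rightarrow> 'a \<Rightarrow> 'a) \<Rightarrow> 'a \<Rightarrow> 'a::complex_banach set"
  where "mccrimmon_radical jp e =
    (GREATEST J. jordan_ideal jp J \<and> (\<forall>x\<in>J. quasi_invertible jp e x))"

definition semisimple :: "('a \<Rightarrow> 'a \<Rightarrow> 'a) \<Rightarrow> 'a::complex_banach \<Rightarrow> bool"
  where "semisimple jp e \<longleftrightarrow> mccrimmon_radical jp e = {0}"

text \<open>The parameter \<open>m\<close> is the group operation. The metric of the group is \<open>dist\<close> of the
  ambient normed space.\<close>

definition invertibles_monoid :: "('a \<Rightarrow> 'a \<Rightarrow> 'a) \<Rightarrow> 'a \<Rightarrow> ('a \<Rightarrow> 'a \<Rightarrow> 'a) \<Rightarrow> 'a monoid"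
  where "invertibles_monoid jp e m = \<lparr>carrier = invertibles jp e, mult = m, one = e\<rparr>"

definition metric_group_isometric_iso ::
    "('a::metric_space) monoid \<Rightarrow> ('b::metric_space) monoid \<Rightarrow> ('a \<Rightarrow> 'b) \<Rightarrow> bool"
  where "metric_group_isometric_iso G H \<Phi> \<longleftrightarrow> group G \<and> group H \<and> \<Phi> \<in> iso G H \<and>
    (\<forall>x\<in>carrier G. \<forall>y\<in>carrier G. dist (\<Phi> x) (\<Phi> y) = dist x y)"

lemma special_jp_commutative:
  "special_jp (a::'a::{real_algebra,comm_ring}) b = a * b"
proof -
  have "a * b + b * a = 2 *\<^sub>R (a * b)" by (simp add: mult.commute scaleR_2)
  then show ?thesis by (simp add: special_jp_def)
qed

lemma unital_jordan_banach_algebra_special: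
  "unital_jordan_banach_algebra special_jp (1::'a::complex_banach_algebra_1)"
proof
  fix a b c :: 'a and k :: complex
  have C: "scaleC k (r *\<^sub>R x) = r *\<^sub>R scaleC k x" for r and x :: 'a
    by (metis mult.commute scaleC_of_real scaleC_scaleC)
  show "special_jp a b = special_jp b a" by (simp add: special_jp_def add.commute)
  show "special_jp (a + b) c = special_jp a c + special_jp b c"
    by (simp add: special_jp_def algebra_simps)
  show "special_jp (scaleC k a) b = scaleC k (special_jp a b)"
    by (simp add: special_jp_def C mult_scaleC_left mult_scaleC_right scaleC_add_right)
  show "special_jp (special_jp a b) (special_jp a a)
      = special_jp a (special_jp b (special_jp a a))"
    by (simp add: special_jp_def algebra_simps)
  have "norm (a * b + b * a) \<le> norm (a * b) + norm (b * a)" by (rule norm_triangle_ineq)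
  also have "\<dots> \<le> 2 * (norm a * norm b)"
    using norm_mult_ineq[of a b] norm_mult_ineq[of b a] by (simp add: mult.commute)
  finally show "norm (special_jp a b) \<le> norm a * norm b" by (simp add: special_jp_def)
  have "a + a = 2 *\<^sub>R a" by (simp add: scaleR_2)
  then show "special_jp 1 a = a" by (simp add: special_jp_def)
qed simp

lemma invertibles_special:
  "invertibles special_jp (1::'a::complex_banach_algebra_1) = {a. \<exists>b. a * b = 1 \<and> b * a = 1}"
proof (intro Set.set_eqI iffI)
  fix a :: 'a
  assume "a \<in> invertibles special_jp 1"
  then obtain b where b: "special_jp a b = 1" "special_jp (special_jp a a) b = a"
    by (auto simp: invertibles_def is_jinverse_def)
  have half: "x = 2 *\<^sub>R y" if "(1/2) *\<^sub>R x = y" for x y :: 'a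
    using that by auto
  have "special_jp a a = a * a"
    by (simp add: special_jp_def flip: scaleR_2)
  with b have "(1/2) *\<^sub>R (a * b + b * a) = 1" "(1/2) *\<^sub>R (a * a * b + b * a * a) = a"
    by (simp_all add: special_jp_def mult.assoc)
  then have s: "a * b + b * a = 2 *\<^sub>R 1" and t: "a * a * b + b * a * a = 2 *\<^sub>R a"
    using half by blast+
  have "a * (a * b + b * a) = 2 *\<^sub>R a" "(a * b + b * a) * a = 2 *\<^sub>R a"
    unfolding s by simp_all
  then have u: "a * a * b + a * b * a = 2 *\<^sub>R a" "a * b * a + b * a * a = 2 *\<^sub>R a"
    by (simp_all add: algebra_simps)
  have "a * b * a = b * a * a" "a * a * b = a * b * a"
    using t u by (metis add_left_cancel, metis add.commute add_left_cancel)
  moreover from this u have "2 *\<^sub>R (a * b * a) = 2 *\<^sub>R a"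
    by (simp add: scaleR_2)
  ultimately have aba: "a * b * a = a" "a * a * b = a" "b * a * a = a" by auto
  have "b * a * (a * b) = b * a" "b * a * (a * b) = a * b"
    using aba by (metis mult.assoc)+
  then have "a * b = b * a" by simp
  with s have "2 *\<^sub>R (a * b) = 2 *\<^sub>R 1" by (simp add: scaleR_2)
  then have "a * b = 1" by simp
  with \<open>a * b = b * a\<close> show "a \<in> {a. \<exists>b. a * b = 1 \<and> b * a = 1}" by auto
next
  fix a :: 'a
  assume "a \<in> {a. \<exists>b. a * b = 1 \<and> b * a = 1}"
  then obtain b where b: "a * b = 1" "b * a = 1" by auto
  then have "a * a * b = a" "b * (a * a) = a"
    by (metis mult.assoc mult_1_right, metis mult.assoc mult_1_left)
  with b have "is_jinverse special_jp 1 a b"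
    by (simp add: is_jinverse_def special_jp_def flip: scaleR_2)
  then show "a \<in> invertibles special_jp 1" by (auto simp: invertibles_def)
qed

end

(* The inverse f of Delta is an isometry onto an open set of invertible elements of A. A local
   Mazur--Ulam theorem makes f affine, x |-> S x + v, on the union of the balls of radius |c|
   around the multiples c e (c nonzero), which lies in the domain of f because it is connected.
   For a character phi of A the function phi o f has no zero there; this forces v = 0 and makes
   c |-> phi (S (c e)) an isometry of the complex plane, whence f = S on its whole domain.
   Since phi o S does not vanish on the powers of the elements of that union, a
   Gleason--Kahane--Zelazko argument shows that phi o S / phi (S e) is multiplicative, up to complex
   conjugation. The characters separate the points of the semisimple algebra A, so
   S e * S (x o y) = S x * S y, and a |-> S^-1 (S e * a) is the required isomorphism. *)

theory Submission
  imports Defs "HOL-Computational_Algebra.Fundamental_Theorem_Algebra"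
begin

section \<open>Unital Jordan--Banach algebras\<close>

text \<open>Characters are available on \<open>A\<close> only, since \<open>N\<close> is not known
  to be associative; hence the argument runs through the inverse of the isometry, whose values
  characters can test. The domain of \<open>f\<close> may have components that miss the balls, and
  there the Mazur--Ulam theorem says nothing; a metric comparison with points of the balls takes
  over. The choice between a character and its conjugate may vary with the character, so
  \<open>S\<close> is only real linear, and \<open>S e\<close> is a unit of norm one that need not
  be \<open>1\<close>, whence the factor \<open>S e\<close> in the product rule. Characters are
  obtained from seminorms instead of maximal ideals and quotient algebras: minimal seminorms are
  multiplicative, and a multiplicative one is the modulus of a character. The
  Gleason--Kahane--Zelazko argument uses roots of polynomials instead of entire functions, so that
  closure under powers is enough.\<close>

lemma scaleC_minus_right: "scaleC c (- x) = - scaleC c (x::'a::complex_banach)"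
  by (metis add.right_inverse minus_unique scaleC_add_right add_cancel_right_left)

lemma scaleC_diff_right: "scaleC c (x - y) = scaleC c x - scaleC c (y::'a::complex_banach)"
  using scaleC_add_right[of c x "- y"] by (simp add: scaleC_minus_right)

lemma scaleC_one [simp]: "scaleC 1 x = (x::'a::complex_banach)"
  using scaleC_of_real[of 1 x] by simp

lemma scaleC_zero_left [simp]: "scaleC 0 x = (0::'a::complex_banach)"
  using scaleC_of_real[of 0 x] by simp

lemma scaleC_zero_right [simp]: "scaleC c 0 = (0::'a::complex_banach)"
  using scaleC_add_right[of c 0 0] by simp

lemma scaleC_minus_left: "scaleC (- c) x = - scaleC c (x::'a::complex_banach)"
  by (metis add.right_inverse minus_unique scaleC_add_left scaleC_zero_left)

lemma scaleC_diff_left: "scaleC (c - d) x = scaleC c x - scaleC d (x::'a::complex_banach)"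
  using scaleC_add_left[of c "- d" x] by (simp add: scaleC_minus_left)

lemma scaleC_scaleR_commute: "scaleC c (r *\<^sub>R x) = r *\<^sub>R scaleC c (x::'a::complex_banach)"
  by (metis mult.commute scaleC_of_real scaleC_scaleC)

lemma bounded_bilinear_scaleC:
  "bounded_bilinear (scaleC :: complex \<Rightarrow> 'a \<Rightarrow> 'a::complex_banach)"
proof
  fix c :: complex and r :: real and x :: 'a
  show "scaleC (r *\<^sub>R c) x = r *\<^sub>R scaleC c x"
    by (metis scaleC_of_real scaleC_scaleC scaleR_conv_of_real)
  show "\<exists>K. \<forall>a x. norm (scaleC a (x::'a)) \<le> norm a * norm x * K"
    by (rule exI[of _ 1]) (simp add: norm_scaleC)
qed (simp_all add: scaleC_add_left scaleC_add_right scaleC_scaleR_commute)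

context unital_jordan_banach_algebra
begin

lemma jp_add_right: "jp a (b + c) = jp a b + jp a c"
  using jp_add_left jp_commute by metis

lemma jp_scaleC_right: "jp a (scaleC k b) = scaleC k (jp a b)"
  using jp_scaleC_left jp_commute by metis

lemma jp_unit_right: "jp a e = a"
  using jp_unit jp_commute by metis

lemma jp_scaleR_left: "jp (r *\<^sub>R a) b = r *\<^sub>R jp a b"
  by (metis jp_scaleC_left scaleC_of_real)

lemma bounded_bilinear_jp: "bounded_bilinear jp"
proof
  show "\<exists>K. \<forall>a b. norm (jp a b) \<le> norm a * norm b * K"
    by (rule exI[of _ 1]) (simp add: norm_jp)
  show "jp a (r *\<^sub>R b) = r *\<^sub>R jp a b" for r a b
    using jp_scaleR_left jp_commute by metis
qed (simp_all add: jp_add_left jp_add_right jp_scaleR_left)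

lemmas jp_diff_left = bounded_bilinear.diff_left [OF bounded_bilinear_jp]
  and jp_diff_right = bounded_bilinear.diff_right [OF bounded_bilinear_jp]
  and jp_zero_left = bounded_bilinear.zero_left [OF bounded_bilinear_jp]
  and jp_zero_right = bounded_bilinear.zero_right [OF bounded_bilinear_jp]
  and jp_scaleR_right = bounded_bilinear.scaleR_right [OF bounded_bilinear_jp]

text \<open>Polarisation: the Jordan identity is cubic in \<open>x\<close>, and its values at
  \<open>b + c\<close>, \<open>b - c\<close> and \<open>c\<close> combine to twice the component of
  degree two in \<open>b\<close> and one in \<open>c\<close>. With L_x for multiplication by
  \<open>x\<close> it reads 2 [L_b, L_bc] = [L_bb, L_c]; the facts on inverses come from
  substitutions into it.\<close>

lemma jordan_identity_linearised:
  "2 *\<^sub>R (jp b (jp (jp b c) w) - jp (jp b c) (jp b w))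
    = jp (jp b b) (jp c w) - jp c (jp (jp b b) w)"
proof -
  have F: "jp (jp x w) (jp x x) = jp x (jp w (jp x x))" for x
    by (rule jordan_identity)
  have "jp (jp (b + c) w) (jp (b + c) (b + c)) - jp (b + c) (jp w (jp (b + c) (b + c)))
    - (jp (jp (b - c) w) (jp (b - c) (b - c)) - jp (b - c) (jp w (jp (b - c) (b - c))))
    - 2 *\<^sub>R (jp (jp c w) (jp c c) - jp c (jp w (jp c c))) = 0"
    unfolding F by simp
  then have "2 *\<^sub>R (jp (jp c w) (jp b b) + 2 *\<^sub>R jp (jp b w) (jp b c)
       - jp c (jp w (jp b b)) - 2 *\<^sub>R jp b (jp w (jp b c))) = 0" (is "_ *\<^sub>R ?X = 0")
    by (simp add: jp_add_left jp_add_right jp_diff_left jp_diff_right jp_commute[of c b]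
        algebra_simps scaleR_2)
  then have "?X = 0"
    by (metis scaleR_eq_0_iff zero_neq_numeral)
  then show ?thesis
    by (simp add: jp_commute[of w] jp_commute[of _ "jp b c"] jp_commute[of _ "jp b b"]
        algebra_simps scaleR_2)
qed

text \<open>As \<open>jp a b = e\<close> acts as the identity, the left side of the linearised
  identity vanishes. So the multiplications by \<open>jp a a\<close> and \<open>b\<close> commute,
  and likewise those by \<open>jp b b\<close> and \<open>a\<close>.\<close>

lemma jinverse_facts:
  assumes "is_jinverse jp e a b"
  shows "jp (jp a a) (jp b w) = jp b (jp (jp a a) w)"
    and "jp (jp b b) (jp a w) = jp a (jp (jp b b) w)"
    and "jp (jp a a) (jp b b) = e"
proof -
  have ab: "jp a b = e" "jp b a = e" "jp (jp a a) b = a"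
    using assms jp_commute by (auto simp: is_jinverse_def)
  show *: "jp (jp a a) (jp b w) = jp b (jp (jp a a) w)" for w
    using jordan_identity_linearised[of a b w] by (simp add: ab jp_unit)
  show "jp (jp b b) (jp a w) = jp a (jp (jp b b) w)"
    using jordan_identity_linearised[of b a w] by (simp add: ab jp_unit)
  show "jp (jp a a) (jp b b) = e"
    using *[of b] by (simp add: ab)
qed

text \<open>Any \<open>z\<close> with \<open>jp a z = 0\<close> has a multiplication that commutes
  with the one by \<open>jp a a\<close>. Applied to the difference \<open>x\<close> this recovers
  \<open>x\<close> as \<open>jp (jp a a) u\<close>; applied to \<open>u\<close> it gives
  \<open>jp b x = 0\<close>. The linearised identity for \<open>b\<close> and \<open>jp a a\<close>,
  whose product is \<open>a\<close>, then yields \<open>jp (jp a a) u = 0\<close>.\<close>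

lemma is_jinverse_unique:
  assumes b: "is_jinverse jp e a b" and b': "is_jinverse jp e a b'"
  shows "b = b'"
proof -
  define x where "x = b - b'"
  define u where "u = jp (jp b b) x"
  have ab: "jp a b = e" "jp b a = e" "jp (jp a a) b = a" "jp b (jp a a) = a"
    using b jp_commute by (auto simp: is_jinverse_def)
  have ax: "jp a x = 0" "jp (jp a a) x = 0"
    using b b' by (auto simp: is_jinverse_def x_def jp_diff_right)
  have comm: "jp (jp a a) (jp z w) = jp z (jp (jp a a) w)" if "jp a z = 0" for z w
    using jordan_identity_linearised[of a z w] that by (simp add: jp_zero_left jp_zero_right)
  have x: "x = jp (jp a a) u"
    using comm[OF ax(1), of "jp b b"] jinverse_facts(3)[OF b]
    by (simp add: u_def jp_unit jp_commute[of x])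
  have au: "jp a u = 0"
    using jinverse_facts(2)[OF b, of x] by (simp add: u_def ax jp_zero_right)
  have "jp b x = jp (jp a a) (jp b u)"
    using jinverse_facts(1)[OF b, of u] x by simp
  also have "\<dots> = 0"
    using comm[OF au, of b] by (simp add: ab au jp_commute[of u])
  finally have bx: "jp b x = 0" .
  have "jp (jp b b) (jp (jp a a) x) - jp (jp a a) (jp (jp b b) x) = 0"
    using jordan_identity_linearised[of b "jp a a" x]
    by (simp add: ab ax bx jp_zero_right)
  then have "jp (jp a a) u = 0"
    by (simp add: ax jp_zero_right u_def)
  with x have "x = 0" by simp
  then show ?thesis by (simp add: x_def)
qed

lemma jinverse_eq: "is_jinverse jp e a b \<Longrightarrow> jinverse jp e a = b"
  unfolding jinverse_def by (blast intro: the_equality is_jinverse_unique)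

section \<open>The unit element in quadratic subsets\<close>

lemma U_op_inverse_square:
  assumes "is_jinverse jp e a b"
  shows "U_op jp a (jp b b) = e"
proof -
  have "jp (jp a (jp b b)) a = e"
    using jinverse_facts(2)[OF assms, of a] jinverse_facts(3)[OF assms]
    by (metis jp_commute)
  then show ?thesis
    using jinverse_facts(3)[OF assms] by (simp add: U_op_def scaleR_2)
qed

lemma unit_in_quadratic_subset:
  assumes q: "quadratic_subset jp e M" and c: "closed_powers_inverses jp e M"
  shows "e \<in> M"
proof -
  obtain a where a: "a \<in> M" "a \<in> invertibles jp e"
    using q by (auto simp: quadratic_subset_def)
  then obtain b where b: "is_jinverse jp e a b" by (auto simp: invertibles_def)
  then have "b \<in> M" using a c jinverse_eq by (auto simp: closed_powers_inverses_def)
  then have "jpower jp e b 2 \<in> M" using c by (auto simp: closed_powers_inverses_def)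
  then have "jp b b \<in> M" by (simp add: numeral_2_eq_2 jp_unit_right)
  then show ?thesis
    using q a U_op_inverse_square[OF b] by (metis quadratic_subset_def)
qed

text \<open>The Jordan identity makes the multiplications by \<open>x\<close> and by its square
  commute; this is the instance of power associativity on which the Neumann series rests.\<close>

lemma jpower_square_mult: "jp (jp x x) (jpower jp e x n) = jpower jp e x (Suc (Suc n))"
proof (induction n)
  case (Suc n)
  have "jp (jp x x) (jp x (jpower jp e x n)) = jp x (jp (jp x x) (jpower jp e x n))"
    using jordan_identity[of x "jpower jp e x n"] jp_commute by metis
  then show ?case using Suc by simp
qed (simp add: jp_unit_right)

lemma norm_jpower: "norm (jpower jp e x n) \<le> norm x ^ n"
proof (induction n)
  case (Suc n)
  then show ?case
    using norm_jp[of x "jpower jp e x n"] mult_left_mono[OF Suc, of "norm x"] by simp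
qed (simp add: norm_unit)

text \<open>A Jordan inverse is tested by two equations, so the sum \<open>b\<close> of the Neumann
  series is multiplied by \<open>x\<close> and by \<open>jp x x\<close>; this shifts the series by
  one and by two places.\<close>

lemma neumann_invertible:
  assumes "norm x < 1"
  shows "e - x \<in> invertibles jp e"
proof -
  let ?p = "jpower jp e x"
  have sp: "summable ?p"
    by (rule summable_comparison_test[of _ "\<lambda>n. norm x ^ n"])
      (use assms norm_jpower in auto)
  define b where "b = suminf ?p"
  have xb: "jp x b = b - e"
  proof -
    have "(\<lambda>n. jp x (?p n)) sums jp x b"
      unfolding b_def by (rule bounded_linear.sums[OF bounded_bilinear.bounded_linear_right
            [OF bounded_bilinear_jp] summable_sums[OF sp]])
    moreover have "(\<lambda>n. ?p (Suc n)) sums (b - e)"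
      using summable_sums[OF sp] sums_Suc_iff[of ?p "b - e"] by (simp add: b_def)
    ultimately show ?thesis using sums_unique2 by auto
  qed
  have xxb: "jp (jp x x) b = b - e - x"
  proof -
    have "(\<lambda>n. jp (jp x x) (?p n)) sums jp (jp x x) b"
      unfolding b_def by (rule bounded_linear.sums[OF bounded_bilinear.bounded_linear_right
            [OF bounded_bilinear_jp] summable_sums[OF sp]])
    moreover have "(\<lambda>n. ?p (Suc (Suc n))) sums (b - e - x)"
      using summable_sums[OF sp] sums_Suc_iff[of ?p "b - e"]
        sums_Suc_iff[of "\<lambda>n. ?p (Suc n)" "b - e - x"] by (simp add: b_def jp_unit_right)
    ultimately show ?thesis using sums_unique2 unfolding jpower_square_mult by auto
  qed
  have "is_jinverse jp e (e - x) b"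
    unfolding is_jinverse_def
    by (simp add: jp_diff_left jp_diff_right jp_unit jp_unit_right xb xxb)
  then show ?thesis by (auto simp: invertibles_def)
qed

lemma invertibles_scaleC:
  assumes "x \<in> invertibles jp e" "c \<noteq> 0"
  shows "scaleC c x \<in> invertibles jp e"
proof -
  obtain b where "is_jinverse jp e x b" using assms by (auto simp: invertibles_def)
  then have "is_jinverse jp e (scaleC c x) (scaleC (inverse c) b)"
    using assms by (simp add: is_jinverse_def jp_scaleC_left jp_scaleC_right scaleC_scaleC
        mult.assoc[symmetric])
  then show ?thesis by (auto simp: invertibles_def)
qed

section \<open>Balls around the complex multiples of the unit\<close>

definition unit_balls :: "'a set"
  where "unit_balls = (\<Union>c\<in>- {0}. ball (scaleC c e) (cmod c))"

lemma open_unit_balls: "open unit_balls"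
  by (auto simp: unit_balls_def)

lemma unit_balls_eq: "unit_balls = (\<lambda>(c, x). scaleC c x) ` ((- {0}) \<times> ball e 1)"
proof (intro equalityI subsetI)
  fix y assume "y \<in> unit_balls"
  then obtain c where c: "c \<noteq> 0" "dist (scaleC c e) y < cmod c" by (auto simp: unit_balls_def)
  have "dist (scaleC c e) y = cmod c * dist e (scaleC (inverse c) y)"
    using c by (simp add: dist_norm scaleC_diff_right scaleC_scaleC flip: norm_scaleC)
  then have "scaleC (inverse c) y \<in> ball e 1"
    using c by simp
  moreover have "y = scaleC c (scaleC (inverse c) y)" using c by (simp add: scaleC_scaleC)
  ultimately show "y \<in> (\<lambda>(c, x). scaleC c x) ` ((- {0}) \<times> ball e 1)"
    using c by (intro image_eqI[of _ _ "(c, scaleC (inverse c) y)"]) auto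
next
  fix y assume "y \<in> (\<lambda>(c, x). scaleC c x) ` ((- {0}) \<times> ball e 1)"
  then obtain c x where c: "c \<noteq> 0" "dist e x < 1" "y = scaleC c x" by force
  have "dist (scaleC c e) y = cmod c * dist e x"
    by (simp add: c dist_norm flip: norm_scaleC scaleC_diff_right)
  then show "y \<in> unit_balls" using c by (force simp: unit_balls_def)
qed

text \<open>The set is a continuous image of the punctured plane times a ball, and the punctured
  plane is connected because its real dimension is two.\<close>

lemma connected_unit_balls: "connected unit_balls"
  unfolding unit_balls_eq case_prod_beta
  by (intro connected_continuous_image bounded_bilinear.continuous_on[OF bounded_bilinear_scaleC]
      continuous_intros connected_Times connected_punctured_universe) auto

lemma unit_balls_invertible: "unit_balls \<subseteq> invertibles jp e"
proof
  fix y assume "y \<in> unit_balls"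
  then obtain c x where c: "c \<noteq> 0" "dist e x < 1" "y = scaleC c x" by (force simp: unit_balls_eq)
  then have "e - (e - x) \<in> invertibles jp e"
    by (intro neumann_invertible) (simp add: dist_norm)
  then show "y \<in> invertibles jp e" using c by (simp add: invertibles_scaleC)
qed

lemma unit_in_unit_balls: "e \<in> unit_balls"
  by (auto simp: unit_balls_def intro!: bexI[of _ 1])

lemma unit_balls_add: "norm x < cmod c \<Longrightarrow> scaleC c e + x \<in> unit_balls"
  by (auto simp: unit_balls_def dist_norm intro!: bexI[of _ c])

lemma unit_balls_subset:
  assumes "clopen_in (invertibles jp e) M" "e \<in> M"
  shows "unit_balls \<subseteq> M"
proof -
  have "openin (top_of_set unit_balls) (unit_balls \<inter> M)"
    "closedin (top_of_set unit_balls) (unit_balls \<inter> M)"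
    using assms unit_balls_invertible unfolding clopen_in_def
    by (auto simp: openin_open closedin_closed)
  then have "unit_balls \<inter> M = unit_balls"
    using connected_unit_balls unit_in_unit_balls assms(2) by (auto simp: connected_clopen)
  then show ?thesis by auto
qed

text \<open>\<open>U_op jp (scaleC s e)\<close> is multiplication by the scalar
  \<open>s\<^sup>2\<close>, so a square root of \<open>c\<close> is the right choice; the
  corresponding multiple of \<open>e\<close> is the centre of one of the balls.\<close>

lemma scaleC_in_quadratic_subset:
  assumes q: "quadratic_subset jp e M" and cl: "clopen_in (invertibles jp e) M" "e \<in> M"
    and x: "x \<in> M" and c: "c \<noteq> 0"
  shows "scaleC c x \<in> M"
proof -
  have "scaleC (csqrt c) e + 0 \<in> unit_balls" by (rule unit_balls_add) (use c in simp)
  then have "scaleC (csqrt c) e \<in> M" using unit_balls_subset[OF cl] by auto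
  then have "U_op jp (scaleC (csqrt c) e) x \<in> M" using q x by (auto simp: quadratic_subset_def)
  moreover have "U_op jp (scaleC (csqrt c) e) x = scaleC c x"
    by (simp add: U_op_def jp_scaleC_left jp_scaleC_right jp_unit jp_unit_right scaleC_scaleC
        scaleR_2 flip: power2_eq_square)
  ultimately show ?thesis by simp
qed

end

section \<open>A local Mazur--Ulam theorem\<close>

text \<open>The nested sets of the classical Mazur--Ulam proof: stage \<open>n\<close> has diameter
  at most \<open>dist x y / 2 ^ n\<close>, and the next stage keeps its approximate centres, the
  points within half of that bound of the whole stage.\<close>

primrec metric_midpoints :: "'a::metric_space \<Rightarrow> 'a \<Rightarrow> nat \<Rightarrow> 'a set" where
  "metric_midpoints x y 0 = {w. dist w x = dist x y / 2 \<and> dist w y = dist x y / 2}"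
| "metric_midpoints x y (Suc n) = {w \<in> metric_midpoints x y n.
    \<forall>u\<in>metric_midpoints x y n. dist w u \<le> dist x y / 2 ^ Suc n}"

lemma metric_midpoints_subset: "metric_midpoints x y n \<subseteq> metric_midpoints x y 0"
  by (induction n) auto

lemma dist_metric_midpoints:
  assumes "w \<in> metric_midpoints x y n" "u \<in> metric_midpoints x y n"
  shows "dist w u \<le> dist x y / 2 ^ n"
proof (cases n)
  case 0
  have "dist w u \<le> dist w x + dist u x" by (rule dist_triangle2)
  also have "\<dots> = dist x y" using assms 0 by (simp add: field_simps)
  finally show ?thesis using 0 by simp
qed (use assms in simp)

text \<open>The distance from the midpoint to \<open>u\<close> is half the distance from
  \<open>u\<close> to its reflection \<open>x + y - u\<close>. Since the reflection preserves each
  stage, the diameter bound of a stage puts the midpoint into the next one; hence the joint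
  induction.\<close>

lemma midpoint_in_metric_midpoints:
  fixes x y :: "'a::real_normed_vector"
  shows "midpoint x y \<in> metric_midpoints x y n
    \<and> (\<forall>w\<in>metric_midpoints x y n. x + y - w \<in> metric_midpoints x y n)"
proof (induction n)
  case 0
  have "dist (x + y - w) x = dist w y" "dist (x + y - w) y = dist w x" for w
    by (auto simp: dist_norm norm_minus_commute algebra_simps)
  then show ?case by (simp add: dist_midpoint)
next
  case (Suc n)
  let ?H = "metric_midpoints x y n"
  have sym: "dist (x + y - w) u = dist w (x + y - u)" for w u
  proof -
    have "x + y - w - u = - (w - (x + y - u))" by simp
    then show ?thesis by (metis dist_norm norm_minus_cancel)
  qed
  have "dist (midpoint x y) u \<le> dist x y / 2 ^ Suc n" if u: "u \<in> ?H" for u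
  proof -
    have "(x + y - u) - u = 2 *\<^sub>R (midpoint x y - u)"
      by (simp add: midpoint_def algebra_simps scaleR_2)
    then have "dist (x + y - u) u = 2 * dist (midpoint x y) u"
      by (simp add: dist_norm)
    moreover have "dist (x + y - u) u \<le> dist x y / 2 ^ n"
      using Suc u by (intro dist_metric_midpoints) auto
    ultimately show ?thesis by simp
  qed
  then show ?case using Suc by (auto simp: sym)
qed

lemma metric_midpoints_unique:
  fixes x y :: "'a::real_normed_vector"
  assumes "\<And>n. w \<in> metric_midpoints x y n"
  shows "w = midpoint x y"
proof -
  have "dist w (midpoint x y) \<le> dist x y * (1 / 2) ^ n" for n
    using dist_metric_midpoints[OF assms, of "midpoint x y" n] midpoint_in_metric_midpoints[of x y n]
    by (simp add: power_one_over field_simps)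
  moreover have "(\<lambda>n. dist x y * (1 / 2) ^ n) \<longlonglongrightarrow> dist x y * 0"
    by (intro tendsto_intros LIMSEQ_power_zero) auto
  ultimately have "dist w (midpoint x y) \<le> dist x y * 0"
    by (intro LIMSEQ_le_const) auto
  then show ?thesis by simp
qed

text \<open>The sets \<open>metric_midpoints\<close> shrink to the algebraic midpoint and are defined by the metric
  alone; hence an isometry whose domain and range contain the first of them preserves midpoints.\<close>

lemma isometry_midpoint:
  fixes f :: "'a::real_normed_vector \<Rightarrow> 'b::real_normed_vector"
  assumes f: "inj_on f B" "f ` B = C" and iso: "\<And>x y. x \<in> B \<Longrightarrow> y \<in> B \<Longrightarrow> dist (f x) (f y) = dist x y"
    and xy: "x \<in> B" "y \<in> B"
    and H: "metric_midpoints x y 0 \<subseteq> B" "metric_midpoints (f x) (f y) 0 \<subseteq> C"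
  shows "f (midpoint x y) = midpoint (f x) (f y)"
proof -
  have *: "f ` metric_midpoints x y n = metric_midpoints (f x) (f y) n" for n
  proof (induction n)
    case 0
    show ?case
    proof (intro equalityI subsetI)
      fix v assume "v \<in> f ` metric_midpoints x y 0"
      then show "v \<in> metric_midpoints (f x) (f y) 0" using H xy iso by auto
    next
      fix v assume v: "v \<in> metric_midpoints (f x) (f y) 0"
      then obtain w where "w \<in> B" "v = f w" using H f by blast
      then show "v \<in> f ` metric_midpoints x y 0" using v xy iso by auto
    qed
  next
    case (Suc n)
    have sub: "metric_midpoints x y n \<subseteq> B" using metric_midpoints_subset H(1) by blast
    have "f ` metric_midpoints x y (Suc n) = {v \<in> f ` metric_midpoints x y n.
        \<forall>u\<in>f ` metric_midpoints x y n. dist v u \<le> dist x y / 2 ^ Suc n}"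
      using sub iso by (auto simp: subset_iff)
    then show ?case unfolding Suc by (simp add: iso xy)
  qed
  show ?thesis
    by (rule metric_midpoints_unique) (use * midpoint_in_metric_midpoints in blast)
qed

section \<open>From midpoints to real linear maps\<close>

lemma additive_norm_preserving_linear:
  fixes S :: "'a::real_normed_vector \<Rightarrow> 'b::real_normed_vector"
  assumes add: "\<And>x y. S (x + y) = S x + S y" and norm: "\<And>x. norm (S x) = norm x"
  shows "linear S"
proof -
  interpret S: additive S by standard (rule add)
  have nat: "S (real n *\<^sub>R x) = real n *\<^sub>R S x" for n x
    by (induction n) (auto simp: S.zero add scaleR_add_left)
  have int: "S (real_of_int k *\<^sub>R x) = real_of_int k *\<^sub>R S x" for k x
    by (cases k rule: int_cases2) (auto simp: nat S.minus)
  have "S (r *\<^sub>R x) = r *\<^sub>R S x" for r x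
  proof -
    \<comment> \<open>Additivity settles integer multiples. Splitting \<open>real n * r\<close> into
      integer and fractional part bounds \<open>n\<close> times the defect of homogeneity
      independently of \<open>n\<close>, so the defect vanishes.\<close>
    have b: "norm (S (r *\<^sub>R x) - r *\<^sub>R S x) * real n \<le> 2 * norm x" for n
    proof -
      let ?k = "\<lfloor>real n * r\<rfloor>" let ?t = "frac (real n * r)"
      have "(real n * r) *\<^sub>R x = real_of_int ?k *\<^sub>R x + ?t *\<^sub>R x"
        by (simp add: frac_def flip: scaleR_add_left)
      then have "S (real n *\<^sub>R (r *\<^sub>R x)) = S (real_of_int ?k *\<^sub>R x) + S (?t *\<^sub>R x)"
        by (simp flip: add)
      then have "real n *\<^sub>R (S (r *\<^sub>R x) - r *\<^sub>R S x) = S (?t *\<^sub>R x) - ?t *\<^sub>R S x"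
        unfolding nat int by (simp add: frac_def algebra_simps)
      then have "real n * norm (S (r *\<^sub>R x) - r *\<^sub>R S x) = norm (S (?t *\<^sub>R x) - ?t *\<^sub>R S x)"
        by (metis norm_scaleR abs_of_nat)
      also have "\<dots> \<le> norm (S (?t *\<^sub>R x)) + norm (?t *\<^sub>R S x)" by (rule norm_triangle_ineq4)
      also have "\<dots> = 2 * (?t * norm x)" by (simp add: norm frac_ge_0)
      also have "\<dots> \<le> 2 * norm x"
        using frac_lt_1[of "real n * r"] by (simp add: mult_left_le_one_le frac_ge_0)
      finally show ?thesis by (simp add: mult.commute)
    qed
    have "norm (S (r *\<^sub>R x) - r *\<^sub>R S x) = 0"
    proof (rule ccontr)
      assume "norm (S (r *\<^sub>R x) - r *\<^sub>R S x) \<noteq> 0"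
      then obtain n where "2 * norm x < real n * norm (S (r *\<^sub>R x) - r *\<^sub>R S x)"
        using reals_Archimedean3[of "norm (S (r *\<^sub>R x) - r *\<^sub>R S x)"] by auto
      then show False using b[of n] by (simp add: mult.commute)
    qed
    then show ?thesis by simp
  qed
  then show ?thesis by (intro linearI add)
qed

text \<open>Since \<open>g 0 = 0\<close>, preserving midpoints entails preserving halves. So
  \<open>2 ^ n *\<^sub>R g ((1/2) ^ n *\<^sub>R x)\<close> does not depend on \<open>n\<close> once
  the argument lies in the ball; this value is \<open>S x\<close>. Additivity of \<open>S\<close> is
  the midpoint property at a small scale.\<close>

lemma midpoint_preserving_extends:
  fixes g :: "'a::real_normed_vector \<Rightarrow> 'b::real_normed_vector"
  assumes r: "r > 0" and g0: "g 0 = 0"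
    and iso: "\<And>x. x \<in> ball 0 r \<Longrightarrow> norm (g x) = norm x"
    and mid: "\<And>x y. x \<in> ball 0 r \<Longrightarrow> y \<in> ball 0 r \<Longrightarrow> g (midpoint x y) = midpoint (g x) (g y)"
    and onto: "ball 0 r \<subseteq> g ` ball 0 r"
  shows "\<exists>S. linear S \<and> surj S \<and> (\<forall>x. norm (S x) = norm x) \<and> (\<forall>x\<in>ball 0 r. g x = S x)"
proof -
  have half: "g ((1/2) *\<^sub>R x) = (1/2) *\<^sub>R g x" if "x \<in> ball 0 r" for x
    using mid[OF that, of 0] r g0 by (simp add: midpoint_def)
  have half': "g ((1/2) ^ n *\<^sub>R x) = (1/2) ^ n *\<^sub>R g x" if x: "x \<in> ball 0 r" for x n
  proof (induction n)
    case (Suc n)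
    have "norm ((1/2) ^ n *\<^sub>R x) \<le> norm x"
      by (simp add: mult_left_le_one_le power_le_one)
    then have "(1/2) ^ n *\<^sub>R x \<in> ball 0 r" using x by simp
    from half[OF this] Suc show ?case by simp
  qed simp
  define S where "S x = 2 ^ (SOME n. (1/2) ^ n *\<^sub>R x \<in> ball 0 r) *\<^sub>R
      g ((1/2) ^ (SOME n. (1/2) ^ n *\<^sub>R x \<in> ball 0 r) *\<^sub>R x)" for x
  have ev: "\<exists>N. \<forall>n\<ge>N. (1/2) ^ n *\<^sub>R x \<in> ball 0 r" for x :: 'a
  proof -
    have "(\<lambda>n. (1/2::real) ^ n *\<^sub>R x) \<longlonglongrightarrow> 0 *\<^sub>R x"
      by (intro tendsto_intros LIMSEQ_power_zero) auto
    then show ?thesis using r by (auto simp: lim_sequentially dist_norm)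
  qed
  have indep: "2 ^ m *\<^sub>R g ((1/2) ^ m *\<^sub>R x) = 2 ^ n *\<^sub>R g ((1/2) ^ n *\<^sub>R x)"
    if "(1/2) ^ m *\<^sub>R x \<in> ball 0 r" "m \<le> n" for m n x
  proof -
    obtain k where n: "n = m + k" using \<open>m \<le> n\<close> le_Suc_ex by blast
    have "g ((1/2) ^ n *\<^sub>R x) = (1/2) ^ k *\<^sub>R g ((1/2) ^ m *\<^sub>R x)"
      using half'[OF that(1), of k] by (simp add: n power_add mult.commute)
    then show ?thesis by (simp add: n power_add power_one_over)
  qed
  have S: "S x = 2 ^ n *\<^sub>R g ((1/2) ^ n *\<^sub>R x)" if "(1/2) ^ n *\<^sub>R x \<in> ball 0 r" for x n
  proof -
    have "(1/2) ^ (SOME n. (1/2) ^ n *\<^sub>R x \<in> ball 0 r) *\<^sub>R x \<in> ball 0 r"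
      using that by (rule someI)
    then show ?thesis
      unfolding S_def using indep that by (metis linorder_le_cases)
  qed
  have norm: "norm (S x) = norm x" for x
  proof -
    obtain n where n: "(1/2) ^ n *\<^sub>R x \<in> ball 0 r" using ev by blast
    show ?thesis using iso[OF n] by (simp add: S[OF n] power_one_over)
  qed
  have add: "S (x + y) = S x + S y" for x y
  proof -
    obtain N1 where N1: "\<forall>n\<ge>N1. (1/2) ^ n *\<^sub>R x \<in> ball 0 r" using ev by blast
    obtain N2 where N2: "\<forall>n\<ge>N2. (1/2) ^ n *\<^sub>R y \<in> ball 0 r" using ev by blast
    obtain N3 where N3: "\<forall>n\<ge>N3. (1/2) ^ n *\<^sub>R (x + y) \<in> ball 0 r" using ev by blast
    define n where "n = max N1 (max N2 N3)"
    have n: "(1/2) ^ n *\<^sub>R x \<in> ball 0 r" "(1/2) ^ n *\<^sub>R y \<in> ball 0 r"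
      "(1/2) ^ Suc n *\<^sub>R (x + y) \<in> ball 0 r"
      using N1 N2 N3 by (auto simp del: mem_ball power_Suc simp: n_def)
    have "g ((1/2) ^ Suc n *\<^sub>R (x + y)) = g (midpoint ((1/2) ^ n *\<^sub>R x) ((1/2) ^ n *\<^sub>R y))"
      by (simp add: midpoint_def scaleR_add_right)
    also have "\<dots> = midpoint (g ((1/2) ^ n *\<^sub>R x)) (g ((1/2) ^ n *\<^sub>R y))"
      by (rule mid) (use n in auto)
    finally show ?thesis
      unfolding S[OF n(1)] S[OF n(2)] S[OF n(3)]
      by (simp add: midpoint_def scaleR_add_right)
  qed
  have eq: "g x = S x" if "x \<in> ball 0 r" for x
    using S[of 0 x] that by simp
  have lin: "linear S" by (rule additive_norm_preserving_linear[OF add norm])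
  have "surj S"
    unfolding surj_def
  proof
    fix y
    obtain n where n: "(1/2) ^ n *\<^sub>R y \<in> ball (0::'b) r"
    proof -
      have "(\<lambda>n. (1/2::real) ^ n *\<^sub>R y) \<longlonglongrightarrow> 0 *\<^sub>R y"
        by (intro tendsto_intros LIMSEQ_power_zero) auto
      then show ?thesis using r that by (auto simp: lim_sequentially dist_norm)
    qed
    then obtain x where x: "x \<in> ball 0 r" "(1/2) ^ n *\<^sub>R y = g x" using onto by blast
    have "S (2 ^ n *\<^sub>R x) = 2 ^ n *\<^sub>R (1/2) ^ n *\<^sub>R y"
      using x(1) eq[of x] linear_scale[OF lin, of "2 ^ n" x] by (simp only: x(2))
    also have "\<dots> = y" by (simp add: power_one_over)
    finally have "S (2 ^ n *\<^sub>R x) = y" .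
    then show "\<exists>x. y = S x" by metis
  qed
  then show ?thesis using lin norm eq by blast
qed

text \<open>Openness of \<open>Q\<close> is what makes \<open>f\<close> carry small balls around
  \<open>a\<close> onto the balls of the same radius around \<open>f a\<close>, so that metric
  midpoints on both sides correspond.\<close>

lemma mazur_ulam_local:
  fixes f :: "'a::real_normed_vector \<Rightarrow> 'b::real_normed_vector"
  assumes inj: "inj_on f P" and im: "f ` P = Q"
    and iso: "\<And>x y. x \<in> P \<Longrightarrow> y \<in> P \<Longrightarrow> dist (f x) (f y) = dist x y"
    and U: "open U" "U \<subseteq> P" and Q: "open Q" and a: "a \<in> U"
  shows "\<exists>r>0. \<exists>S v. ball a r \<subseteq> U \<and> linear S \<and> surj S \<and> (\<forall>x. norm (S x) = norm x)
    \<and> (\<forall>x\<in>ball a r. f x = S x + v)"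
proof -
  obtain r1 where r1: "r1 > 0" "ball a r1 \<subseteq> U" using U a open_contains_ball by blast
  have "f a \<in> Q" using a U im by auto
  then obtain r2 where r2: "r2 > 0" "ball (f a) r2 \<subseteq> Q" using Q open_contains_ball by blast
  define r where "r = min r1 r2"
  have r: "r > 0" "ball a r \<subseteq> U" "ball (f a) r \<subseteq> Q"
    using r1 r2 by (auto simp: r_def)
  have aP: "a \<in> P" "ball a r \<subseteq> P" using a U r by auto
  have onto: "f ` ball a s = ball (f a) s" if s: "s \<le> r" for s
  proof (intro equalityI subsetI)
    fix y assume "y \<in> f ` ball a s"
    then obtain x where "y = f x" "dist a x < s" by auto
    moreover from this have "x \<in> P" using aP s by auto
    ultimately show "y \<in> ball (f a) s" using iso[OF aP(1)] by simp
  next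
    fix y assume y: "y \<in> ball (f a) s"
    then have "y \<in> Q" using r(3) s by auto
    then obtain x where "x \<in> P" "y = f x" using im by auto
    then show "y \<in> f ` ball a s" using y iso[OF aP(1)] by auto
  qed
  define g where "g h = f (a + h) - f a" for h
  \<comment> \<open>The radius \<open>r/3\<close> leaves room: a metric midpoint \<open>w\<close> is
    at distance \<open>dist x y / 2 < r/3\<close> from \<open>x\<close>, hence at distance less than
    \<open>2 * r / 3\<close> from the centre.\<close>
  have sub: "metric_midpoints x y 0 \<subseteq> ball c r" if "x \<in> ball c (r/3)" "y \<in> ball c (r/3)"
    for x y c :: "'c::real_normed_vector"
  proof
    fix w assume "w \<in> metric_midpoints x y 0"
    then have "dist w x = dist x y / 2" by simp
    moreover have "dist x y \<le> dist c x + dist c y" by (metis dist_commute dist_triangle2)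
    moreover have "dist c w \<le> dist c x + dist w x" by (metis dist_triangle dist_commute)
    ultimately show "w \<in> ball c r" using that zero_le_dist[of c x] unfolding mem_ball by linarith
  qed
  have r3: "r / 3 \<le> r" "r / 3 > 0" using r(1) by auto
  have "\<exists>S. linear S \<and> surj S \<and> (\<forall>x. norm (S x) = norm x) \<and> (\<forall>x\<in>ball 0 (r/3). g x = S x)"
  proof (rule midpoint_preserving_extends[OF r3(2)])
    show "g 0 = 0" by (simp add: g_def)
    have b: "a + x \<in> ball a (r/3)" if "x \<in> ball 0 (r/3)" for x
      using that by (simp add: dist_norm)
    show "norm (g x) = norm x" if "x \<in> ball 0 (r/3)" for x
    proof -
      have "a + x \<in> P" using b[OF that] aP r3(1) by auto
      then show ?thesis using iso[OF _ aP(1), of "a + x"] by (simp add: g_def dist_norm)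
    qed
    show "g (midpoint x y) = midpoint (g x) (g y)"
      if "x \<in> ball 0 (r/3)" "y \<in> ball 0 (r/3)" for x y
    proof -
      have xy: "a + x \<in> ball a (r/3)" "a + y \<in> ball a (r/3)" using that b by auto
      then have fxy: "f (a + x) \<in> ball (f a) (r/3)" "f (a + y) \<in> ball (f a) (r/3)"
        using onto[OF r3(1)] by blast+
      have xy': "a + x \<in> ball a r" "a + y \<in> ball a r" using xy r3(1) by auto
      have "f (midpoint (a + x) (a + y)) = midpoint (f (a + x)) (f (a + y))"
        by (rule isometry_midpoint[OF inj_on_subset[OF inj aP(2)] onto[OF order_refl] _ xy'
              sub[OF xy] sub[OF fxy]])
          (use iso aP in blast)
      moreover have "midpoint (a + x) (a + y) = a + midpoint x y"
        by (simp add: midpoint_def algebra_simps flip: scaleR_add_left)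
      ultimately have "g (midpoint x y) = midpoint (f (a + x)) (f (a + y)) - f a"
        by (simp add: g_def)
      then show ?thesis
        by (simp add: g_def midpoint_def algebra_simps flip: scaleR_add_left)
    qed
    show "ball 0 (r/3) \<subseteq> g ` ball 0 (r/3)"
    proof
      fix y :: 'b assume "y \<in> ball 0 (r/3)"
      then have "f a + y \<in> ball (f a) (r/3)" by (simp add: dist_norm)
      then obtain x where x: "x \<in> ball a (r/3)" "f a + y = f x" using onto[OF r3(1)] by blast
      then show "y \<in> g ` ball 0 (r/3)"
        by (intro image_eqI[of _ _ "x - a"]) (auto simp: g_def dist_norm norm_minus_commute algebra_simps)
    qed
  qed
  then obtain S where S: "linear S" "surj S" "\<forall>x. norm (S x) = norm x"
    "\<forall>x\<in>ball 0 (r/3). g x = S x" by blast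
  have "f x = S x + (f a - S a)" if "x \<in> ball a (r/3)" for x
  proof -
    have "x - a \<in> ball 0 (r/3)" using that by (simp add: dist_norm norm_minus_commute)
    then have "g (x - a) = S (x - a)" using S by blast
    then show ?thesis by (simp add: g_def linear_diff[OF S(1)] algebra_simps)
  qed
  moreover have "ball a (r/3) \<subseteq> U" using r r3 by force
  ultimately show ?thesis using S(1-3) r3(2) by blast
qed

lemma linear_eq_on_ball:
  fixes S S' :: "'a::real_normed_vector \<Rightarrow> 'b::real_vector"
  assumes "linear S" "linear S'" "r > 0" and eq: "\<And>x. x \<in> ball a r \<Longrightarrow> S x + v = S' x + v'"
  shows "S = S' \<and> v = v'"
proof -
  have "S x = S' x" for x
  proof -
    define t where "t = r / (2 * (norm x + 1))"
    have t: "t > 0" using assms by (simp add: t_def add_nonneg_pos)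
    have "norm (t *\<^sub>R x) = r * (norm x / (2 * (norm x + 1)))" using t \<open>r > 0\<close> by (simp add: t_def)
    also have "\<dots> < r * 1" using assms(3)
      by (intro mult_strict_left_mono) (auto simp: divide_less_eq add_nonneg_pos intro: add_strict_increasing2)
    finally have 1: "S (a + t *\<^sub>R x) + v = S' (a + t *\<^sub>R x) + v'"
      by (intro eq) (simp add: dist_norm)
    have 2: "S a + v = S' a + v'" using assms by (intro eq) simp
    have "(S (a + t *\<^sub>R x) + v) - (S a + v) = (S' (a + t *\<^sub>R x) + v') - (S' a + v')"
      unfolding 1 2 ..
    then have "t *\<^sub>R S x = t *\<^sub>R S' x"
      using assms(1,2) by (simp add: linear_add linear_scale)
    then show ?thesis using t by simp
  qed
  moreover from this have "v = v'" using eq[of a] assms by simp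
  ultimately show ?thesis by auto
qed

text \<open>Two affine maps that agree on a ball are equal. So a ball supplied by the local theorem
  lies in the set \<open>W\<close>, where \<open>f\<close> is locally \<open>S x + v\<close>, as
  soon as it meets \<open>W\<close>; thus \<open>W\<close> and its complement in \<open>U\<close>
  are open.\<close>

lemma mazur_ulam_connected:
  fixes f :: "'a::real_normed_vector \<Rightarrow> 'b::real_normed_vector"
  assumes inj: "inj_on f P" and im: "f ` P = Q"
    and iso: "\<And>x y. x \<in> P \<Longrightarrow> y \<in> P \<Longrightarrow> dist (f x) (f y) = dist x y"
    and U: "open U" "U \<subseteq> P" "connected U" "U \<noteq> {}" and Q: "open Q"
  obtains S v where "linear S" "surj S" "\<And>x. norm (S x) = norm x" "\<And>x. x \<in> U \<Longrightarrow> f x = S x + v"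
proof -
  have loc: "\<exists>r>0. \<exists>S v. ball a r \<subseteq> U \<and> linear S \<and> surj S \<and> (\<forall>x. norm (S x) = norm x)
    \<and> (\<forall>x\<in>ball a r. f x = S x + v)" if "a \<in> U" for a
    using mazur_ulam_local[OF inj im _ U(1,2) Q that] iso by blast
  obtain a where a: "a \<in> U" using U by auto
  obtain r S v where S: "r > 0" "ball a r \<subseteq> U" "linear S" "surj S" "\<forall>x. norm (S x) = norm x"
    "\<forall>x\<in>ball a r. f x = S x + v" using loc[OF a] by blast
  define W where "W = {x\<in>U. \<exists>s>0. ball x s \<subseteq> U \<and> (\<forall>y\<in>ball x s. f y = S y + v)}"
  have aW: "a \<in> W" using a S by (auto simp: W_def)
  have *: "\<exists>s>0. ball x s \<subseteq> U \<and> (ball x s \<subseteq> W \<or> ball x s \<inter> W = {})" if x: "x \<in> U" for x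
  proof -
    obtain s S' v' where s: "s > 0" "ball x s \<subseteq> U" "linear S'" "\<forall>y\<in>ball x s. f y = S' y + v'"
      using loc[OF x] by blast
    have "ball x s \<subseteq> W" if y: "y \<in> ball x s" "y \<in> W" for y
    proof -
      obtain t where t: "t > 0" "\<forall>z\<in>ball y t. f z = S z + v" using y by (auto simp: W_def)
      obtain t' where t': "t' > 0" "ball y t' \<subseteq> ball x s"
        using y(1) open_contains_ball[of "ball x s"] by (meson open_ball)
      have "S = S' \<and> v = v'"
      proof (rule linear_eq_on_ball[OF S(3) s(3), of "min t t'" y])
        fix z assume "z \<in> ball y (min t t')"
        then have "z \<in> ball y t" "z \<in> ball x s" using t' by auto
        then show "S z + v = S' z + v'" using t s by metis
      qed (use t t' in auto)
      then have *: "\<forall>y\<in>ball x s. f y = S y + v" using s by auto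
      show ?thesis
      proof
        fix z assume z: "z \<in> ball x s"
        then obtain t where "t > 0" "ball z t \<subseteq> ball x s"
          using open_contains_ball[of "ball x s"] by (meson open_ball)
        then show "z \<in> W" using * s z by (auto simp: W_def intro!: exI[of _ t])
      qed
    qed
    then show ?thesis using s by blast
  qed
  have "open W"
    unfolding open_contains_ball
  proof
    fix x assume x: "x \<in> W"
    then obtain s where "s > 0" "ball x s \<subseteq> W \<or> ball x s \<inter> W = {}" using *[of x] W_def by auto
    then show "\<exists>s>0. ball x s \<subseteq> W" using x centre_in_ball by blast
  qed
  moreover have "open (U - W)"
    unfolding open_contains_ball
  proof
    fix x assume x: "x \<in> U - W"
    then obtain s where "s > 0" "ball x s \<subseteq> U" "ball x s \<subseteq> W \<or> ball x s \<inter> W = {}" using *[of x] by auto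
    then show "\<exists>s>0. ball x s \<subseteq> U - W" using x centre_in_ball by blast
  qed
  ultimately have "U - W = {}"
    using connectedD[OF U(3), of W "U - W"] aW a by auto
  then have "f x = S x + v" if "x \<in> U" for x using that by (force simp: W_def)
  then show ?thesis using that S by blast
qed

section \<open>Characters of commutative Banach algebras\<close>

text \<open>Such seminorms replace quotient algebras: their zero sets are proper ideals when
  multiplication is commutative, and the modulus of a character is one of them.\<close>

definition algebra_seminorm :: "('a::complex_banach_algebra_1 \<Rightarrow> real) \<Rightarrow> bool"
  where "algebra_seminorm p \<longleftrightarrow> p 1 = 1 \<and> (\<forall>x. p x \<le> norm x)
    \<and> (\<forall>x y. p (x + y) \<le> p x + p y) \<and> (\<forall>c x. p (scaleC c x) = cmod c * p x)
    \<and> (\<forall>x y. p (x * y) \<le> p x * p y)"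

lemma algebra_seminormD:
  assumes "algebra_seminorm p"
  shows "p 1 = 1" "p x \<le> norm x" "p (x + y) \<le> p x + p y" "p (scaleC c x) = cmod c * p x"
    "p (x * y) \<le> p x * p y" "p 0 = 0" "p (- x) = p x" "p (x - y) = p (y - x)"
    "p (x - y) \<le> p x + p y" "0 \<le> p x"
proof -
  show p: "p 1 = 1" "p x \<le> norm x" "p (x + y) \<le> p x + p y" "p (scaleC c x) = cmod c * p x"
    "p (x * y) \<le> p x * p y" for x y c
    using assms by (auto simp: algebra_seminorm_def)
  show 0: "p 0 = 0" using p(4)[of 0 0] by (simp add: scaleC_zero_left)
  show m: "p (- x) = p x" for x
    using p(4)[of "- 1" x] by (simp add: scaleC_minus_left)
  show "p (x - y) = p (y - x)" using m[of "x - y"] by simp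
  show "p (x - y) \<le> p x + p y" using p(3)[of x "- y"] m[of y] by simp
  show "0 \<le> p x" using p(3)[of x "- x"] 0 m[of x] by simp
qed

lemma algebra_seminorm_power: "algebra_seminorm p \<Longrightarrow> p (x ^ n) \<le> p x ^ n"
proof (induction n)
  case (Suc n)
  have "p (x * x ^ n) \<le> p x * p (x ^ n)" using Suc by (simp add: algebra_seminormD)
  also have "\<dots> \<le> p x * p x ^ n" using Suc by (intro mult_left_mono) (auto simp: algebra_seminormD)
  finally show ?case by simp
qed (simp add: algebra_seminormD)

text \<open>The counterpart of a maximal ideal.\<close>

definition minimal_seminorm :: "('a::complex_banach_algebra_1 \<Rightarrow> real) \<Rightarrow> bool"
  where "minimal_seminorm p \<longleftrightarrow> algebra_seminorm p \<and> (\<forall>q. algebra_seminorm q \<and> q \<le> p \<longrightarrow> q = p)"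

lemma minimal_seminorm_exists:
  assumes q: "algebra_seminorm (q :: 'a::complex_banach_algebra_1 \<Rightarrow> real)"
  obtains p where "minimal_seminorm p" "p \<le> q"
proof -
  define A where "A = {p. algebra_seminorm p \<and> p \<le> q}"
  have "\<exists>m\<in>A. \<forall>a\<in>A. a \<le> m \<longrightarrow> a = m"
  proof (rule predicate_Zorn[where P = "\<lambda>p q. q \<le> p"])
    show "partial_order_on A (relation_of (\<lambda>p q. q \<le> p) A)"
      by (rule partial_order_on_relation_ofI) auto
    fix C assume C: "C \<in> Chains (relation_of (\<lambda>p q. q \<le> p) A)"
    then have tot: "r \<le> s \<or> s \<le> r" and CA: "r \<in> A" if "r \<in> C" "s \<in> C" for r s
      using that by (auto simp: Chains_def relation_of_def)
    show "\<exists>u\<in>A. \<forall>a\<in>C. u \<le> a"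
    proof (cases "C = {}")
      case True
      then show ?thesis using q by (auto simp: A_def)
    next
      case ne: False
      define u where "u x = (INF r\<in>C. r x)" for x
      have al: "algebra_seminorm r" if "r \<in> C" for r using CA[OF that that] by (simp add: A_def)
      have bdd: "bdd_below ((\<lambda>r. r x) ` C)" for x
        by (rule bdd_belowI[of _ 0]) (use al in \<open>auto simp: algebra_seminormD\<close>)
      have le: "u x \<le> r x" if "r \<in> C" for r x
        unfolding u_def by (rule cINF_lower[OF bdd that])
      have gr: "b \<le> u x" if "\<And>r. r \<in> C \<Longrightarrow> b \<le> r x" for b x
        unfolding u_def by (rule cINF_greatest[OF ne that])
      have near: "\<exists>r\<in>C. r x < u x + d" if "d > 0" for x and d :: real
        using gr[of "u x + d" x] that by (meson linorder_not_le less_add_same_cancel1)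
      \<comment> \<open>Sums and products involve two arguments at once; as \<open>C\<close> is a
        chain, a single \<open>r\<close> is nearly minimal at both.\<close>
      have near2: "\<exists>r\<in>C. r x < u x + d \<and> r y < u y + d" if d: "d > 0" for x y and d :: real
      proof -
        obtain r s where rs: "r \<in> C" "s \<in> C" "r x < u x + d" "s y < u y + d"
          using near[OF d] by meson
        then show ?thesis using tot[of r s] by (meson le_funD order_le_less_trans)
      qed
      obtain r0 where r0: "r0 \<in> C" using ne by auto
      have u0: "0 \<le> u x" for x by (rule gr) (simp add: al algebra_seminormD)
      have "u (x + y) \<le> u x + u y" for x y
      proof (rule field_le_epsilon)
        fix d :: real assume "d > 0"
        then obtain r where r: "r \<in> C" "r x < u x + d/2" "r y < u y + d/2"
          using near2[of "d/2"] by auto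
        have "u (x + y) \<le> r (x + y)" by (rule le[OF r(1)])
        also have "\<dots> \<le> r x + r y" by (rule algebra_seminormD[OF al[OF r(1)]])
        finally show "u (x + y) \<le> u x + u y + d" using r by simp
      qed
      moreover have "u (scaleC c x) = cmod c * u x" for c x
      proof (cases "c = 0")
        case True
        have "u 0 \<le> 0" using le[OF r0, of 0] by (simp add: algebra_seminormD[OF al[OF r0]])
        then show ?thesis using True u0[of 0] by (simp add: scaleC_zero_left)
      next
        case False
        have "cmod c * u x \<le> u (scaleC c x)"
          by (rule gr) (simp add: algebra_seminormD al mult_left_mono le)
        moreover have "u (scaleC c x) / cmod c \<le> u x"
          by (rule gr) (use le[of _ "scaleC c x"] False in
              \<open>auto simp: algebra_seminormD al divide_le_eq mult.commute\<close>)
        ultimately show ?thesis using False by (simp add: divide_le_eq mult.commute)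
      qed
      moreover have "u (x * y) \<le> u x * u y" for x y
      proof -
        have "u (x * y) \<le> (u x + d) * (u y + d)" if d: "d > 0" for d
        proof -
          obtain r where r: "r \<in> C" "r x < u x + d" "r y < u y + d"
            using near2[OF d] by auto
          have "u (x * y) \<le> r (x * y)" by (rule le[OF r(1)])
          also have "\<dots> \<le> r x * r y" by (rule algebra_seminormD[OF al[OF r(1)]])
          also have "\<dots> \<le> (u x + d) * (u y + d)"
            using r u0[of x] d by (intro mult_mono) (auto simp: algebra_seminormD al)
          finally show ?thesis .
        qed
        moreover have "((\<lambda>d. (u x + d) * (u y + d)) \<longlongrightarrow> (u x + 0) * (u y + 0)) (at_right 0)"
          by (intro tendsto_intros)
        ultimately have "u (x * y) \<le> (u x + 0) * (u y + 0)"
          by (intro tendsto_lowerbound[of _ _ "at_right (0::real)"])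
            (auto simp: eventually_at_right_less intro!: eventually_at_rightI[of 0 1])
        then show ?thesis by simp
      qed
      moreover have "u 1 = 1"
        using le[OF r0, of 1] gr[of 1 1] by (auto simp: algebra_seminormD al r0 intro: antisym)
      moreover have "u x \<le> norm x" for x
        using le[OF r0] algebra_seminormD(2)[OF al[OF r0]] order_trans by blast
      ultimately have "algebra_seminorm u" by (simp add: algebra_seminorm_def)
      moreover have "u \<le> q" using CA[OF r0 r0] le[OF r0] by (auto simp: A_def le_fun_def intro: order_trans)
      ultimately show ?thesis using le by (auto simp: A_def le_fun_def)
    qed
  qed
  then obtain m where m: "m \<in> A" "\<And>a. a \<in> A \<Longrightarrow> a \<le> m \<Longrightarrow> a = m" by blast
  have "minimal_seminorm m"
    using m by (auto simp: minimal_seminorm_def A_def intro: order_trans)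
  then show ?thesis using that m by (auto simp: A_def)
qed

text \<open>The spectral radius with respect to \<open>p\<close> is again an algebra seminorm, so it equals \<open>p\<close>.\<close>

lemma minimal_seminorm_square:
  fixes p :: "'a::{complex_banach_algebra_1, comm_ring_1} \<Rightarrow> real"
  assumes p: "minimal_seminorm p"
  shows "p (a * a) = p a * p a"
proof -
  have al: "algebra_seminorm p" using p by (simp add: minimal_seminorm_def)
  note P = algebra_seminormD[OF al]
  \<comment> \<open>The infimum \<open>s x\<close> of these growth rates is the limit of the
    \<open>n\<close>-th roots of \<open>p (x ^ n)\<close>; estimates for rates avoid taking the
    roots.\<close>
  define G where "G x \<alpha> \<longleftrightarrow> \<alpha> > 0 \<and> (\<exists>C. \<forall>n. p (x ^ n) \<le> C * \<alpha> ^ n)" for x and \<alpha> :: real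
  have Gmono: "G x \<beta>" if *: "G x \<alpha>" "\<alpha> \<le> \<beta>" for x \<alpha> \<beta>
  proof -
    obtain C where C: "\<alpha> > 0" "\<And>n. p (x ^ n) \<le> C * \<alpha> ^ n" using * by (auto simp: G_def)
    have "1 \<le> C" using C(2)[of 0] by (simp add: P)
    then have "C * \<alpha> ^ n \<le> C * \<beta> ^ n" for n
      using C * by (intro mult_left_mono power_mono) auto
    then show ?thesis using C * unfolding G_def by (meson order_trans order_less_le_trans)
  qed
  have Gp: "G x \<alpha>" if "p x \<le> \<alpha>" "\<alpha> > 0" for x \<alpha>
  proof -
    have "p (x ^ n) \<le> 1 * \<alpha> ^ n" for n
      using algebra_seminorm_power[OF al, of x n] power_mono[OF that(1), of n] P(10)[of x] by simp
    then show ?thesis using that unfolding G_def by blast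
  qed
  define s where "s x = Inf {\<alpha>. G x \<alpha>}" for x
  have ne: "{\<alpha>. G x \<alpha>} \<noteq> {}" for x
    using Gp[of x "p x + 1"] P(10)[of x] by auto
  have bdd: "bdd_below {\<alpha>. G x \<alpha>}" for x
    by (rule bdd_belowI[of _ 0]) (auto simp: G_def)
  have le: "s x \<le> \<alpha>" if "G x \<alpha>" for x \<alpha>
    unfolding s_def by (rule cInf_lower) (use that bdd in auto)
  have gr: "b \<le> s x" if "\<And>\<alpha>. G x \<alpha> \<Longrightarrow> b \<le> \<alpha>" for b x
    unfolding s_def by (rule cInf_greatest) (use that ne in auto)
  have near: "G x (s x + d)" if "d > 0" for x and d :: real
    using gr[of x "s x + d"] that Gmono by (meson linorder_not_le less_add_same_cancel1 less_imp_le)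
  have s0: "0 \<le> s x" for x by (rule gr) (simp add: G_def)
  have sp: "s x \<le> p x" for x
  proof (rule field_le_epsilon)
    fix d :: real assume "d > 0"
    then show "s x \<le> p x + d" by (intro le Gp) (use P(10)[of x] in auto)
  qed
  \<comment> \<open>Commutativity enters through the binomial theorem, and below through
    \<open>(x * y) ^ n = x ^ n * y ^ n\<close>.\<close>
  have Gadd: "G (x + y) (\<alpha> + \<beta>)" if xy: "G x \<alpha>" "G y \<beta>" for x y \<alpha> \<beta>
  proof -
    obtain C where C: "\<alpha> > 0" "\<And>n. p (x ^ n) \<le> C * \<alpha> ^ n" using xy by (auto simp: G_def)
    obtain D where D: "\<beta> > 0" "\<And>n. p (y ^ n) \<le> D * \<beta> ^ n" using xy by (auto simp: G_def)
    have C0: "1 \<le> C" using C(2)[of 0] by (simp add: P)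
    have "p ((x + y) ^ n) \<le> (C * D) * (\<alpha> + \<beta>) ^ n" for n
    proof -
      have psum: "p (\<Sum>k\<in>K. h k) \<le> (\<Sum>k\<in>K. p (h k))" if "finite K" for h and K :: "nat set"
        using that by (induction K) (auto simp: P(6) intro: order_trans[OF P(3)])
      have "p ((x + y) ^ n) = p (\<Sum>k\<le>n. of_nat (n choose k) * x ^ k * y ^ (n - k))"
        by (simp add: binomial_ring)
      also have "\<dots> \<le> (\<Sum>k\<le>n. p (of_nat (n choose k) * x ^ k * y ^ (n - k)))"
        by (rule psum) simp
      also have "\<dots> \<le> (\<Sum>k\<le>n. real (n choose k) * ((C * \<alpha> ^ k) * (D * \<beta> ^ (n - k))))"
      proof (rule sum_mono)
        fix k
        have "of_nat (n choose k) * x ^ k * y ^ (n - k)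
            = scaleC (of_nat (n choose k)) (x ^ k * y ^ (n - k))"
          by (metis scaleC_of_real of_real_of_nat_eq scaleR_conv_of_real mult.assoc)
        then have "p (of_nat (n choose k) * x ^ k * y ^ (n - k))
            = real (n choose k) * p (x ^ k * y ^ (n - k))"
          by (simp add: P(4))
        also have "\<dots> \<le> real (n choose k) * ((C * \<alpha> ^ k) * (D * \<beta> ^ (n - k)))"
          using C D C0 by (intro mult_left_mono order_trans[OF P(5)] mult_mono) (auto simp: P(10))
        finally show "p (of_nat (n choose k) * x ^ k * y ^ (n - k))
          \<le> real (n choose k) * ((C * \<alpha> ^ k) * (D * \<beta> ^ (n - k)))" .
      qed
      also have "\<dots> = (C * D) * (\<alpha> + \<beta>) ^ n"
        by (simp add: binomial_ring sum_distrib_left mult_ac)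
      finally show ?thesis .
    qed
    then show ?thesis using C D unfolding G_def by (meson add_pos_pos)
  qed
  have Gmult: "G (x * y) (\<alpha> * \<beta>)" if xy: "G x \<alpha>" "G y \<beta>" for x y \<alpha> \<beta>
  proof -
    obtain C where C: "\<alpha> > 0" "\<And>n. p (x ^ n) \<le> C * \<alpha> ^ n" using xy by (auto simp: G_def)
    obtain D where D: "\<beta> > 0" "\<And>n. p (y ^ n) \<le> D * \<beta> ^ n" using xy by (auto simp: G_def)
    have C0: "1 \<le> C" using C(2)[of 0] by (simp add: P)
    have "p ((x * y) ^ n) \<le> (C * D) * (\<alpha> * \<beta>) ^ n" for n
    proof -
      have "p (x ^ n * y ^ n) \<le> (C * \<alpha> ^ n) * (D * \<beta> ^ n)"
        using C D C0 by (intro order_trans[OF P(5)] mult_mono) (auto simp: P(10))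
      then show ?thesis by (simp add: power_mult_distrib mult_ac)
    qed
    then show ?thesis using C D unfolding G_def by (meson mult_pos_pos)
  qed
  have scpow: "(scaleC c x) ^ n = scaleC (c ^ n) (x ^ n)" for c and x :: 'a and n
    by (induction n) (auto simp: mult_scaleC_left mult_scaleC_right scaleC_scaleC mult.commute)
  have Gscale: "G (scaleC c x) (cmod c * \<alpha>)" if *: "c \<noteq> 0" "G x \<alpha>" for c x \<alpha>
  proof -
    obtain C where C: "\<alpha> > 0" "\<And>n. p (x ^ n) \<le> C * \<alpha> ^ n" using * by (auto simp: G_def)
    have "p ((scaleC c x) ^ n) \<le> C * (cmod c * \<alpha>) ^ n" for n
      using mult_left_mono[OF C(2)[of n], of "cmod c ^ n"]
      by (simp add: scpow P(4) norm_power power_mult_distrib mult_ac)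
    then show ?thesis using C * by (auto simp: G_def)
  qed
  have "s (x + y) \<le> s x + s y" for x y
  proof (rule field_le_epsilon)
    fix d :: real assume "d > 0"
    then show "s (x + y) \<le> s x + s y + d"
      using le[OF Gadd[OF near[of "d/2" x] near[of "d/2" y]]] by simp
  qed
  moreover have sc: "s (scaleC c x) \<le> cmod c * s x" if "c \<noteq> 0" for c x
  proof (rule field_le_epsilon)
    fix d :: real assume "d > 0"
    then have "d / cmod c > 0" using that by simp
    from le[OF Gscale[OF that near[OF this, of x]]] show "s (scaleC c x) \<le> cmod c * s x + d"
      using that by (simp add: algebra_simps)
  qed
  have "s (scaleC c x) = cmod c * s x" for c x
  proof (cases "c = 0")
    case True
    then show ?thesis using s0[of 0] sp[of 0] by (simp add: scaleC_zero_left P)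
  next
    case False
    have "s x \<le> cmod (inverse c) * s (scaleC c x)"
      using sc[of "inverse c" "scaleC c x"] False by (simp add: scaleC_scaleC scaleC_one)
    then have "cmod c * s x \<le> cmod c * (cmod (inverse c) * s (scaleC c x))"
      by (rule mult_left_mono) simp
    then show ?thesis using sc[of c x] False by (simp add: norm_inverse norm_divide field_simps)
  qed
  moreover have "s (x * y) \<le> s x * s y" for x y
  proof -
    have "s (x * y) \<le> (s x + d) * (s y + d)" if d: "d > 0" for d
      by (rule le[OF Gmult[OF near[OF d] near[OF d]]])
    moreover have "((\<lambda>d. (s x + d) * (s y + d)) \<longlongrightarrow> (s x + 0) * (s y + 0)) (at_right 0)"
      by (intro tendsto_intros)
    ultimately have "s (x * y) \<le> (s x + 0) * (s y + 0)"
      by (intro tendsto_lowerbound[of _ _ "at_right (0::real)"])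
        (auto intro!: eventually_at_rightI[of 0 1])
    then show ?thesis by simp
  qed
  moreover have "s 1 = 1"
  proof (rule antisym)
    show "s 1 \<le> 1" using sp[of 1] by (simp add: P)
    show "1 \<le> s 1"
    proof (rule gr)
      fix \<alpha> assume "G 1 \<alpha>"
      then obtain C where C: "\<alpha> > 0" "\<And>n. 1 \<le> C * \<alpha> ^ n" by (auto simp: G_def P)
      show "1 \<le> \<alpha>"
      proof (rule ccontr)
        assume "\<not> 1 \<le> \<alpha>"
        then have "(\<lambda>n. C * \<alpha> ^ n) \<longlonglongrightarrow> C * 0"
          using C by (intro tendsto_intros LIMSEQ_power_zero) auto
        then have "1 \<le> C * 0" using C(2) by (intro LIMSEQ_le_const) auto
        then show False by simp
      qed
    qed
  qed
  moreover have "s x \<le> norm x" for x using sp P(2) order_trans by blast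
  ultimately have "algebra_seminorm s" by (simp add: algebra_seminorm_def)
  then have "s = p" using p sp by (auto simp: minimal_seminorm_def le_fun_def)
  have "p a \<le> \<alpha>" if \<alpha>: "\<alpha> > 0" "p (a * a) \<le> \<alpha> * \<alpha>" for \<alpha>
  proof -
    have e: "p ((a * a) ^ k) \<le> (\<alpha> * \<alpha>) ^ k" for k
      using algebra_seminorm_power[OF al, of "a * a" k] power_mono[OF \<alpha>(2), of k] P(10) by (meson order_trans)
    \<comment> \<open>The bound on \<open>p (a * a)\<close> controls even powers; an odd power has
      one factor \<open>a\<close> left over, which costs \<open>p a / \<alpha>\<close>. The constant
      serves both parities.\<close>
    have "p (a ^ n) \<le> (1 + p a / \<alpha>) * \<alpha> ^ n" for n
    proof (cases "even n")
      case True
      then obtain k where n: "n = 2 * k" by auto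
      have "p (a ^ n) \<le> 1 * \<alpha> ^ n"
        using e[of k] by (simp add: n power_mult power2_eq_square)
      also have "\<dots> \<le> (1 + p a / \<alpha>) * \<alpha> ^ n"
        using \<alpha> P(10)[of a] by (intro mult_right_mono) auto
      finally show ?thesis .
    next
      case False
      then obtain k where n: "n = Suc (2 * k)" using oddE by fastforce
      have "p (a ^ n) \<le> p a * p ((a * a) ^ k)"
        using P(5)[of a "(a * a) ^ k"] by (simp add: n power_mult power2_eq_square)
      also have "\<dots> \<le> p a * (\<alpha> * \<alpha>) ^ k" by (intro mult_left_mono e P(10))
      also have "\<dots> = p a / \<alpha> * \<alpha> ^ n" using \<alpha> by (simp add: n power_mult power2_eq_square)
      also have "\<dots> \<le> (1 + p a / \<alpha>) * \<alpha> ^ n" using \<alpha> by (intro mult_right_mono) auto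
      finally show ?thesis .
    qed
    then have "G a \<alpha>" using \<alpha> by (auto simp: G_def)
    then show ?thesis using le \<open>s = p\<close> by auto
  qed
  then have "p a \<le> sqrt (p (a * a)) + d" if "d > 0" for d
    using that P(10)[of "a * a"]
    by (metis (no_types, opaque_lifting) abs_of_nonneg add_nonneg_pos less_add_same_cancel1 less_imp_le
        mult_mono real_sqrt_ge_zero real_sqrt_mult_self)
  then have "p a \<le> sqrt (p (a * a))" by (rule field_le_epsilon)
  then have "p a * p a \<le> p (a * a)"
    using mult_mono[of "p a" "sqrt (p (a * a))" "p a" "sqrt (p (a * a))"] by (simp add: P(10))
  then show ?thesis using P(5)[of a a] by simp
qed

text \<open>Apply minimality to the seminorm that sends \<open>y\<close> to the limit of \<open>p (y * a ^ n) / p a ^ n\<close>.\<close>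

lemma minimal_seminorm_mult:
  fixes p :: "'a::{complex_banach_algebra_1, comm_ring_1} \<Rightarrow> real"
  assumes p: "minimal_seminorm p"
  shows "p (x * a) = p x * p a"
proof (cases "p a = 0")
  case True
  then show ?thesis
    using p algebra_seminormD(5,10)[of p] by (metis antisym minimal_seminorm_def mult_zero_right)
next
  case False
  have al: "algebra_seminorm p" using p by (simp add: minimal_seminorm_def)
  note P = algebra_seminormD[OF al]
  have pa: "p a > 0" using False P(10)[of a] by simp
  define h where "h y n = p (y * a ^ n) / p a ^ n" for y n
  have dec: "decseq (h y)" for y
  proof (rule decseq_SucI)
    fix n
    have "p (y * a ^ Suc n) \<le> p (y * a ^ n) * p a"
      using P(5)[of "y * a ^ n" a] by (simp add: mult_ac)
    then show "h y (Suc n) \<le> h y n"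
      using pa by (simp add: h_def field_simps)
  qed
  have h0: "0 \<le> h y n" for y n using pa P(10) by (simp add: h_def)
  define q where "q y = lim (h y)" for y
  have lim: "h y \<longlonglongrightarrow> q y" for y
  proof -
    have "Bseq (h y)"
      by (rule BseqI'[of _ "h y 0"]) (use h0 decseqD[OF dec, of 0] in auto)
    then have "convergent (h y)" using dec Bseq_monoseq_convergent by (simp add: decseq_imp_monoseq)
    then show ?thesis by (simp add: q_def convergent_LIMSEQ_iff)
  qed
  have qp: "q y \<le> p y" for y
    using decseq_ge[OF dec lim, of y 0] by (simp add: h_def)
  have "q (y + z) \<le> q y + q z" for y z
  proof (rule LIMSEQ_le[OF lim tendsto_add[OF lim lim]], intro exI allI impI)
    fix n
    show "h (y + z) n \<le> h y n + h z n"
      using P(3)[of "y * a ^ n" "z * a ^ n"] pa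
      by (simp add: h_def distrib_right divide_right_mono flip: add_divide_distrib)
  qed
  moreover have "q (scaleC c y) = cmod c * q y" for c y
  proof -
    have "h (scaleC c y) = (\<lambda>n. cmod c * h y n)"
      by (auto simp: h_def mult_scaleC_left P(4))
    then show ?thesis using lim[of "scaleC c y"] tendsto_mult_left[OF lim[of y], of "cmod c"]
      by (metis LIMSEQ_unique)
  qed
  \<comment> \<open>Along even indices \<open>a ^ (2 * n)\<close> can be shared equally between
    \<open>y\<close> and \<open>z\<close>.\<close>
  moreover have "q (y * z) \<le> q y * q z" for y z
  proof (rule LIMSEQ_le)
    show "(\<lambda>n. h y n * h z n) \<longlonglongrightarrow> q y * q z" by (intro tendsto_mult lim)
    show "(\<lambda>n. h (y * z) (2 * n)) \<longlonglongrightarrow> q (y * z)"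
      using LIMSEQ_subseq_LIMSEQ[OF lim, of "\<lambda>n. 2 * n" "y * z"] by (simp add: o_def strict_mono_def)
    have "p (y * z * a ^ (2 * n)) \<le> p (y * a ^ n) * p (z * a ^ n)" for n
      using P(5)[of "y * a ^ n" "z * a ^ n"] by (simp add: mult_2 mult_2_right power_add mult_ac)
    then have "h (y * z) (2 * n) \<le> h y n * h z n" for n
      using pa by (simp add: h_def mult_2 power_add divide_right_mono)
    then show "\<exists>N. \<forall>n\<ge>N. h (y * z) (2 * n) \<le> h y n * h z n" by blast
  qed
  \<comment> \<open>By the square identity the sequence \<open>h 1\<close> equals 1 at all powers of
    two, so its limit is 1.\<close>
  moreover have "q 1 = 1"
  proof -
    have sq: "p (a ^ (2 ^ k)) = p a ^ (2 ^ k)" for k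
    proof (induction k)
      case (Suc k)
      then show ?case
        using minimal_seminorm_square[OF p, of "a ^ (2 ^ k)"] by (simp add: mult_2 power_add)
    qed simp
    have "(\<lambda>k. h 1 (2 ^ k)) \<longlonglongrightarrow> q 1"
      using LIMSEQ_subseq_LIMSEQ[OF lim, of "\<lambda>k. 2 ^ k" "1"] by (simp add: o_def strict_mono_def)
    then show ?thesis
      using pa by (simp add: h_def sq LIMSEQ_const_iff)
  qed
  moreover have "q y \<le> norm y" for y using qp P(2) order_trans by blast
  ultimately have "algebra_seminorm q" by (simp add: algebra_seminorm_def)
  then have "q = p" using p qp by (auto simp: minimal_seminorm_def le_fun_def)
  have "q x \<le> h x 1" by (rule decseq_ge[OF dec lim])
  then have "p x * p a \<le> p (x * a)"
    using pa by (simp add: \<open>q = p\<close> h_def le_divide_eq)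
  then show ?thesis using P(5)[of x a] by simp
qed

text \<open>Ostrowski's argument: if \<open>m\<close> is the least value of \<open>p (x - c)\<close> and it is positive, then
  the factorisation of \<open>y ^ 2\<^sup>j - c ^ 2\<^sup>j\<close> shows that moving away from a minimiser \<open>y\<close> by less than
  \<open>m\<close> leads to another minimiser, whereas \<open>p (x - c)\<close> tends to infinity with \<open>c\<close>.\<close>

lemma multiplicative_seminorm_scalar:
  fixes p :: "'a::{complex_banach_algebra_1, comm_ring_1} \<Rightarrow> real"
  assumes al: "algebra_seminorm p" and mult: "\<And>x y. p (x * y) = p x * p y"
  shows "\<exists>c. p (x - scaleC c 1) = 0"
proof -
  note P = algebra_seminormD[OF al]
  have p1: "p (scaleC c 1) = cmod c" for c by (simp add: P)
  obtain c0 where c0: "\<And>c. p (x - scaleC c0 1) \<le> p (x - scaleC c 1)"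
  proof -
    have lip: "\<bar>p (x - scaleC c 1) - p (x - scaleC d 1)\<bar> \<le> 1 * dist c d" for c d
    proof -
      have "p (x - scaleC c 1) \<le> p (x - scaleC d 1) + cmod (c - d)" for c d
        using P(9)[of "x - scaleC d 1" "scaleC (c - d) 1"] by (simp only: p1) (simp add: scaleC_diff_left)
      from this[of c d] this[of d c] show ?thesis by (simp add: dist_norm norm_minus_commute abs_le_iff)
    qed
    \<comment> \<open>Outside this disc \<open>p (x - scaleC c 1) \<ge> cmod c - p x > p x\<close>,
      which exceeds the value at \<open>c = 0\<close>, so a minimum over the disc is global.\<close>
    have "continuous_on (cball 0 (2 * p x)) (\<lambda>c. p (x - scaleC c 1))"
      by (rule lipschitz_on_continuous_on[of 1]) (auto simp: lipschitz_on_def dist_real_def lip[simplified])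
    then obtain c0 where c0: "c0 \<in> cball 0 (2 * p x)"
      "\<And>c. c \<in> cball 0 (2 * p x) \<Longrightarrow> p (x - scaleC c0 1) \<le> p (x - scaleC c 1)"
      using continuous_attains_inf[of "cball 0 (2 * p x)" "\<lambda>c. p (x - scaleC c 1)"] P(10)[of x] by force
    have "p (x - scaleC c0 1) \<le> p (x - scaleC c 1)" if "c \<notin> cball 0 (2 * p x)" for c
    proof -
      have "p (x - scaleC c0 1) \<le> p x" using c0(2)[of 0] P(10)[of x] by simp
      moreover have "cmod c \<le> p x + p (x - scaleC c 1)"
        using P(9)[of x "x - scaleC c 1"] by (simp add: p1)
      ultimately show ?thesis using that by simp
    qed
    then show ?thesis using that c0 by blast
  qed
  define m where "m = p (x - scaleC c0 1)"
  show ?thesis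
  proof (rule ccontr)
    assume "\<nexists>c. p (x - scaleC c 1) = 0"
    then have m: "m > 0" using P(10)[of "x - scaleC c0 1"] by (auto simp: m_def order_less_le)
    have min: "m \<le> p (x - scaleC c 1)" for c using c0 by (simp add: m_def)
    have step: "p (x - scaleC (c + d) 1) = m" if c: "p (x - scaleC c 1) = m" and d: "cmod d < m" for c d
    proof -
      define y where "y = x - scaleC c 1"
      have sc2: "scaleC a 1 * scaleC b 1 = (scaleC (a * b) 1 :: 'a)" for a b
        by (simp add: mult_scaleC_left scaleC_scaleC)
      \<comment> \<open>Exponents that are powers of two need only square roots: each factorisation
        halves the exponent until the minimality of \<open>m\<close> applies.\<close>
      have A: "m ^ (2 ^ j) \<le> p (y ^ (2 ^ j) - scaleC s 1)" for j s
      proof (induction j arbitrary: s)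
        case 0
        show ?case using min[of "c + s"] by (simp add: y_def scaleC_add_left diff_diff_eq)
      next
        case (Suc j)
        have sq: "scaleC (csqrt s) 1 * scaleC (csqrt s) 1 = (scaleC s 1 :: 'a)"
          by (simp only: sc2 power2_csqrt[unfolded power2_eq_square])
        have "y ^ (2 ^ Suc j) - scaleC s 1
            = (y ^ (2 ^ j) - scaleC (csqrt s) 1) * (y ^ (2 ^ j) - scaleC (- csqrt s) 1)"
          by (simp add: scaleC_minus_left algebra_simps sq mult_2 mult_2_right power_add)
        then show ?case
          using mult_mono[OF Suc[of "csqrt s"] Suc[of "- csqrt s"]] m
          by (simp add: mult mult_2 power_add P(10))
      qed
      \<comment> \<open>Split off \<open>y - d\<close> from the difference of the powers; the
        remaining factors \<open>y ^ 2 ^ i + d ^ 2 ^ i\<close> for \<open>i < j\<close> are bounded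
        below by A, and their exponents add up to \<open>2 ^ j - 1\<close>.\<close>
      have B: "p (y - scaleC d 1) * m ^ (2 ^ j - 1) \<le> p (y ^ (2 ^ j) - scaleC (d ^ (2 ^ j)) 1)" for j
      proof (induction j)
        case (Suc j)
        have e: "y ^ (2 ^ Suc j) - scaleC (d ^ (2 ^ Suc j)) 1
            = (y ^ (2 ^ j) - scaleC (d ^ (2 ^ j)) 1) * (y ^ (2 ^ j) - scaleC (- (d ^ (2 ^ j))) 1)"
          by (simp add: scaleC_minus_left algebra_simps sc2 mult_2 mult_2_right power_add)
        have "(2::nat) ^ Suc j - 1 = (2 ^ j - 1) + 2 ^ j" by simp
        then have "p (y - scaleC d 1) * m ^ (2 ^ Suc j - 1)
            = (p (y - scaleC d 1) * m ^ (2 ^ j - 1)) * m ^ (2 ^ j)"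
          by (simp only: power_add mult.assoc)
        also have "\<dots> \<le> p (y ^ (2 ^ j) - scaleC (d ^ (2 ^ j)) 1) * p (y ^ (2 ^ j) - scaleC (- (d ^ (2 ^ j))) 1)"
          by (intro mult_mono Suc A) (use m in \<open>auto simp: P(10)\<close>)
        finally show ?case by (simp only: e mult)
      qed simp
      have pw: "p (y ^ n) = m ^ n" for n
        by (induction n) (use c in \<open>auto simp: y_def mult P(1)\<close>)
      have "p (y - scaleC d 1) \<le> m * (1 + (cmod d / m) ^ (2 ^ j))" for j
      proof -
        have "p (y - scaleC d 1) * m ^ (2 ^ j - 1) \<le> m ^ (2 ^ j) + cmod d ^ (2 ^ j)"
          using B[of j] P(9)[of "y ^ (2 ^ j)" "scaleC (d ^ (2 ^ j)) 1"] by (simp add: p1 pw norm_power)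
        also have "\<dots> = m ^ (2 ^ j) * (1 + (cmod d / m) ^ (2 ^ j))"
          using m by (simp add: power_divide distrib_left)
        also have "\<dots> = m * (1 + (cmod d / m) ^ (2 ^ j)) * m ^ (2 ^ j - 1)"
          by (subst power_eq_if) simp
        finally show ?thesis using m by (simp add: mult_le_cancel_right)
      qed
      moreover have "(\<lambda>j. m * (1 + (cmod d / m) ^ (2 ^ j))) \<longlonglongrightarrow> m * (1 + 0)"
      proof (intro tendsto_intros)
        have "(\<lambda>n. (cmod d / m) ^ n) \<longlonglongrightarrow> 0" using m d by (intro LIMSEQ_power_zero) auto
        then show "(\<lambda>j. (cmod d / m) ^ (2 ^ j)) \<longlonglongrightarrow> 0"
          using LIMSEQ_subseq_LIMSEQ[of _ 0 "\<lambda>k. 2 ^ k"] by (fastforce simp: o_def strict_mono_def)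
      qed
      ultimately have "p (y - scaleC d 1) \<le> m * (1 + 0)" by (intro LIMSEQ_le_const) auto
      then have "p (y - scaleC d 1) \<le> m" by simp
      then show ?thesis
        using min[of "c + d"] by (simp add: y_def scaleC_add_left diff_diff_eq)
    qed
    have "p (x - scaleC (c0 + of_nat k * of_real (m / 2)) 1) = m" for k
    proof (induction k)
      case (Suc k)
      have "c0 + of_nat (Suc k) * of_real (m / 2) = c0 + of_nat k * of_real (m / 2) + of_real (m / 2)"
        by (simp only: of_nat_Suc distrib_right mult_1_left add_ac)
      moreover have "cmod (of_real (m / 2)) < m" using m by simp
      ultimately show ?case using step[OF Suc] by metis
    qed (simp add: m_def)
    then have "cmod (of_nat k * of_real (m / 2)) \<le> 2 * m" for k
      using P(9)[of "x - scaleC c0 1" "x - scaleC (c0 + of_nat k * of_real (m / 2)) 1"]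
      by (simp add: p1 scaleC_add_left m_def[symmetric] algebra_simps)
    \<comment> \<open>Five steps of length \<open>m / 2\<close> are the first to exceed the bound
      \<open>2 * m\<close>.\<close>
    from this[of 5] m show False by (simp add: norm_mult)
  qed
qed

section \<open>Characters from multiplicative seminorms\<close>

definition is_character :: "('a::complex_banach_algebra_1 \<Rightarrow> complex) \<Rightarrow> bool"
  where "is_character \<phi> \<longleftrightarrow> \<phi> 1 = 1 \<and> (\<forall>x y. \<phi> (x + y) = \<phi> x + \<phi> y)
    \<and> (\<forall>c x. \<phi> (scaleC c x) = c * \<phi> x) \<and> (\<forall>x y. \<phi> (x * y) = \<phi> x * \<phi> y) \<and> (\<forall>x. cmod (\<phi> x) \<le> norm x)"

lemma is_characterD:
  assumes "is_character \<phi>"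
  shows "\<phi> 1 = 1" "\<phi> (x + y) = \<phi> x + \<phi> y" "\<phi> (scaleC c x) = c * \<phi> x" "\<phi> (x * y) = \<phi> x * \<phi> y"
    "cmod (\<phi> x) \<le> norm x" "\<phi> 0 = 0" "\<phi> (- x) = - \<phi> x" "\<phi> (x - y) = \<phi> x - \<phi> y"
    "\<phi> (r *\<^sub>R x) = r *\<^sub>R \<phi> x"
proof -
  show P: "\<phi> 1 = 1" "\<phi> (x + y) = \<phi> x + \<phi> y" "\<phi> (scaleC c x) = c * \<phi> x" "\<phi> (x * y) = \<phi> x * \<phi> y"
    "cmod (\<phi> x) \<le> norm x" for x y c using assms by (auto simp: is_character_def)
  show "\<phi> 0 = 0" using P(3)[of 0 0] by simp
  show n: "\<phi> (- x) = - \<phi> x" for x using P(3)[of "-1" x] by (simp add: scaleC_minus_left)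
  show "\<phi> (x - y) = \<phi> x - \<phi> y" using P(2)[of x "- y"] n[of y] by simp
  show "\<phi> (r *\<^sub>R x) = r *\<^sub>R \<phi> x"
    using P(3)[of "of_real r" x] by (simp add: scaleC_of_real scaleR_conv_of_real)
qed

text \<open>Modulo the zero set of \<open>p\<close> every element is a scalar, and a unique one
  because \<open>p (scaleC c 1) = cmod c\<close>. This scalar is \<open>\<phi> x\<close>, and each
  algebraic law follows by checking that the expected scalar has the defining property.\<close>

lemma multiplicative_seminorm_character:
  fixes p :: "'a::{complex_banach_algebra_1, comm_ring_1} \<Rightarrow> real"
  assumes al: "algebra_seminorm p" and mult: "\<And>x y. p (x * y) = p x * p y"
  obtains \<phi> where "is_character \<phi>" "\<And>x. cmod (\<phi> x) = p x"
proof -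
  note P = algebra_seminormD[OF al]
  have p1: "p (scaleC c 1) = cmod c" for c by (simp add: P)
  obtain \<phi> where \<phi>: "\<And>x. p (x - scaleC (\<phi> x) 1) = 0"
    using multiplicative_seminorm_scalar[OF al mult] by metis
  have uniq: "\<phi> x = c" if "p (x - scaleC c 1) = 0" for x c
  proof -
    have "p (scaleC (\<phi> x - c) 1) \<le> p (x - scaleC c 1) + p (x - scaleC (\<phi> x) 1)"
      using P(9)[of "x - scaleC c 1" "x - scaleC (\<phi> x) 1"] by (simp add: scaleC_diff_left)
    then show ?thesis by (simp add: p1 that \<phi>)
  qed
  have zero: "p z = 0" if "p z \<le> a + b" "a = 0" "b = 0" for z a b using that P(10)[of z] by simp
  have abs: "cmod (\<phi> x) = p x" for x
    using P(9)[of x "x - scaleC (\<phi> x) 1"] P(3)[of "x - scaleC (\<phi> x) 1" "scaleC (\<phi> x) 1"]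
    by (simp add: p1 \<phi>)
  have "is_character \<phi>"
    unfolding is_character_def
  proof (intro conjI allI)
    show "\<phi> 1 = 1" by (rule uniq) (simp add: P)
    show "cmod (\<phi> x) \<le> norm x" for x using abs P(2) by simp
    show "\<phi> (scaleC c x) = c * \<phi> x" for c x
      using P(4)[of c "x - scaleC (\<phi> x) 1"] \<phi>[of x]
      by (intro uniq) (simp add: scaleC_diff_right scaleC_scaleC)
    show "\<phi> (x + y) = \<phi> x + \<phi> y" for x y
      by (rule uniq, rule zero[OF _ \<phi>[of x] \<phi>[of y]])
        (use P(3)[of "x - scaleC (\<phi> x) 1" "y - scaleC (\<phi> y) 1"] in \<open>simp add: scaleC_add_left algebra_simps\<close>)
    show "\<phi> (x * y) = \<phi> x * \<phi> y" for x y
    proof (rule uniq)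
      have "x * y - scaleC (\<phi> x * \<phi> y) 1
          = (x - scaleC (\<phi> x) 1) * y + scaleC (\<phi> x) (y - scaleC (\<phi> y) 1)"
        by (simp add: algebra_simps mult_scaleC_left mult_scaleC_right scaleC_diff_right scaleC_scaleC)
      then show "p (x * y - scaleC (\<phi> x * \<phi> y) 1) = 0"
        using P(3)[of "(x - scaleC (\<phi> x) 1) * y" "scaleC (\<phi> x) (y - scaleC (\<phi> y) 1)"]
        by (intro zero[of _ 0 0]) (simp_all add: mult P(4) \<phi>)
    qed
  qed
  then show ?thesis using that abs by blast
qed

text \<open>The seminorm \<open>q\<close> is the distance to the principal ideal generated by
  \<open>x\<close>. A multiple of \<open>x\<close> at distance less than 1 from the unit would be
  invertible by the Neumann series, making \<open>x\<close> a unit; hence \<open>q 1 = 1\<close>. A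
  minimal seminorm below \<open>q\<close> vanishes at \<open>x\<close>, and so does its
  character.\<close>

lemma nonunit_character:
  fixes x :: "'a::{complex_banach_algebra_1, comm_ring_1}"
  assumes x: "\<not> x dvd 1"
  obtains \<phi> where "is_character \<phi>" "\<phi> x = 0"
proof -
  define q where "q y = (INF z. norm (y + x * z))" for y
  have bdd: "bdd_below (range (\<lambda>z. norm (y + x * z)))" for y
    by (rule bdd_belowI[of _ 0]) auto
  have le: "q y \<le> norm (y + x * z)" for y z
    unfolding q_def by (rule cINF_lower[OF bdd]) simp
  have gr: "b \<le> q y" if "\<And>z. b \<le> norm (y + x * z)" for b y
    unfolding q_def by (rule cINF_greatest) (use that in auto)
  have near: "\<exists>z. norm (y + x * z) < q y + d" if "d > 0" for y d
    using gr[of "q y + d" y] that by (meson linorder_not_le less_add_same_cancel1)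
  have q0: "0 \<le> q y" for y by (rule gr) simp
  have "q 1 = 1"
  proof (rule antisym)
    show "q 1 \<le> 1" using le[of 1 0] by simp
    show "1 \<le> q 1"
    proof (rule gr, rule ccontr)
      fix z assume "\<not> 1 \<le> norm (1 + x * z)"
      then have "1 - (1 + x * z) \<in> invertibles special_jp 1"
        by (intro unital_jordan_banach_algebra.neumann_invertible
            [OF unital_jordan_banach_algebra_special]) auto
      then obtain b where "(- x * z) * b = 1" by (auto simp: invertibles_special)
      then have "1 = x * (- z * b)" by (simp add: algebra_simps)
      then show False using x by (metis dvdI)
    qed
  qed
  moreover have "q y \<le> norm y" for y using le[of y 0] by simp
  moreover have "q (y + y') \<le> q y + q y'" for y y'
  proof (rule field_le_epsilon)
    fix d :: real assume d: "d > 0"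
    obtain z z' where z: "norm (y + x * z) < q y + d/2" "norm (y' + x * z') < q y' + d/2"
      using near[of "d/2"] d by (meson half_gt_zero)
    have "q (y + y') \<le> norm ((y + x * z) + (y' + x * z'))"
      using le[of "y + y'" "z + z'"] by (simp add: algebra_simps)
    also have "\<dots> \<le> norm (y + x * z) + norm (y' + x * z')" by (rule norm_triangle_ineq)
    finally show "q (y + y') \<le> q y + q y' + d" using z by simp
  qed
  moreover have sc: "q (scaleC c y) \<le> cmod c * q y" for c y
  proof (rule field_le_epsilon)
    fix d :: real assume d: "d > 0"
    then have "d / (cmod c + 1) > 0" by (simp add: add_nonneg_pos)
    then obtain z where z: "norm (y + x * z) < q y + d / (cmod c + 1)" using near by meson
    have "q (scaleC c y) \<le> cmod c * norm (y + x * z)"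
      using le[of "scaleC c y" "scaleC c z"]
      by (simp add: mult_scaleC_right flip: scaleC_add_right norm_scaleC)
    also have "\<dots> \<le> cmod c * (q y + d / (cmod c + 1))" using z by (intro mult_left_mono) auto
    also have "\<dots> \<le> cmod c * q y + d"
      using d by (simp add: distrib_left divide_le_eq add_nonneg_pos mult.commute[of d])
    finally show "q (scaleC c y) \<le> cmod c * q y + d" .
  qed
  moreover have "cmod c * q y \<le> q (scaleC c y)" for c y
  proof (cases "c = 0")
    case False
    then have "q y \<le> q (scaleC c y) / cmod c"
      using sc[of "inverse c" "scaleC c y"] by (simp add: scaleC_scaleC norm_inverse norm_divide field_simps)
    then show ?thesis using False by (simp add: field_simps)
  qed (simp add: q0)
  moreover have "q (y * y') \<le> q y * q y'" for y y'
  proof -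
    have "q (y * y') \<le> (q y + d) * (q y' + d)" if d: "d > 0" for d
    proof -
      obtain z z' where z: "norm (y + x * z) < q y + d" "norm (y' + x * z') < q y' + d"
        using near d by meson
      have "q (y * y') \<le> norm ((y + x * z) * (y' + x * z'))"
        using le[of "y * y'" "y * z' + z * y' + x * z * z'"] by (simp add: algebra_simps)
      also have "\<dots> \<le> norm (y + x * z) * norm (y' + x * z')" by (rule norm_mult_ineq)
      also have "\<dots> \<le> (q y + d) * (q y' + d)"
        using z q0[of y] d by (intro mult_mono) auto
      finally show ?thesis .
    qed
    moreover have "((\<lambda>d. (q y + d) * (q y' + d)) \<longlongrightarrow> (q y + 0) * (q y' + 0)) (at_right 0)"
      by (intro tendsto_intros)
    ultimately have "q (y * y') \<le> (q y + 0) * (q y' + 0)"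
      by (intro tendsto_lowerbound[of _ _ "at_right (0::real)"])
        (auto intro!: eventually_at_rightI[of 0 1])
    then show ?thesis by simp
  qed
  ultimately have "algebra_seminorm q" by (auto simp: algebra_seminorm_def intro: antisym)
  then obtain p where p: "minimal_seminorm p" "p \<le> q" by (rule minimal_seminorm_exists)
  then have al: "algebra_seminorm p" by (simp add: minimal_seminorm_def)
  obtain \<phi> where \<phi>: "is_character \<phi>" "\<And>x. cmod (\<phi> x) = p x"
    using multiplicative_seminorm_character[OF al minimal_seminorm_mult[OF p(1)]] by blast
  have "q x \<le> 0" using le[of x "- 1"] by simp
  then have "\<phi> x = 0" using \<phi>(2)[of x] le_funD[OF p(2), of x] norm_ge_zero[of "\<phi> x"]
    by (metis antisym norm_eq_zero order_trans)
  then show ?thesis using that \<phi> by blast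
qed

section \<open>Characters and the radical\<close>

lemma invertibles_commutative:
  "invertibles special_jp (1::'a::{complex_banach_algebra_1, comm_ring_1}) = {a. a dvd 1}"
  by (auto simp: invertibles_special dvd_def mult.commute)

lemma character_unit_nonzero: "is_character \<phi> \<Longrightarrow> a dvd 1 \<Longrightarrow> \<phi> a \<noteq> 0"
  by (metis dvd_def is_characterD(1,4) mult_zero_left zero_neq_one)

lemma quasi_invertible_ideal_character:
  fixes K :: "'a::{complex_banach_algebra_1, comm_ring_1} set"
  assumes K: "\<And>x a. x \<in> K \<Longrightarrow> a * x \<in> K" "\<And>x. x \<in> K \<Longrightarrow> 1 - x dvd 1"
    and \<phi>: "is_character \<phi>" and x: "x \<in> K"
  shows "\<phi> x = 0"
proof (rule ccontr)
  assume nz: "\<phi> x \<noteq> 0"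
  have "\<phi> (1 - scaleC (inverse (\<phi> x)) 1 * x) \<noteq> 0"
    using K x by (intro character_unit_nonzero[OF \<phi>]) auto
  then show False using nz by (simp add: is_characterD[OF \<phi>])
qed

text \<open>The McCrimmon radical is the common kernel \<open>J\<close> of all characters. It
  consists of quasi-invertible elements because a non-unit is annihilated by some character, and it
  contains every competing ideal by the preceding lemma.\<close>

lemma semisimple_character:
  fixes x :: "'a::{complex_banach_algebra_1, comm_ring_1}"
  assumes ss: "semisimple special_jp (1::'a)" and x: "\<And>\<phi>. is_character \<phi> \<Longrightarrow> \<phi> x = 0"
  shows "x = 0"
proof -
  define J where "J = {x::'a. \<forall>\<phi>. is_character \<phi> \<longrightarrow> \<phi> x = 0}"
  have "mccrimmon_radical special_jp 1 = J"
    unfolding mccrimmon_radical_def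
  proof (rule Greatest_equality)
    have "jordan_ideal special_jp J"
      by (auto simp: jordan_ideal_def complex_subspace_def J_def U_op_def special_jp_commutative
          is_characterD)
    moreover have "quasi_invertible special_jp 1 x" if "x \<in> J" for x
    proof (rule ccontr)
      assume "\<not> quasi_invertible special_jp 1 x"
      then have "\<not> 1 - x dvd 1" by (simp add: quasi_invertible_def invertibles_commutative)
      then obtain \<phi> where "is_character \<phi>" "\<phi> (1 - x) = 0" by (rule nonunit_character)
      then show False using that by (auto simp: J_def is_characterD)
    qed
    ultimately show "jordan_ideal special_jp J \<and> (\<forall>x\<in>J. quasi_invertible special_jp 1 x)" by blast
  next
    fix K :: "'a set"
    assume K: "jordan_ideal special_jp K \<and> (\<forall>x\<in>K. quasi_invertible special_jp 1 x)"
    have sub: "scaleC c x \<in> K" "x + y \<in> K" "a * a * x \<in> K" if "x \<in> K" "y \<in> K" for c x y a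
    proof -
      show "scaleC c x \<in> K" "x + y \<in> K"
        using K that by (auto simp: jordan_ideal_def complex_subspace_def)
      have "U_op special_jp a x \<in> K" using K that by (auto simp: jordan_ideal_def)
      then show "a * a * x \<in> K"
        by (simp add: U_op_def special_jp_commutative algebra_simps scaleR_2)
    qed
    have "a * x \<in> K" if x: "x \<in> K" for a x
    proof -
      \<comment> \<open>In the commutative case \<open>U_op\<close> multiplies by squares only; the
        difference of the squares of \<open>a + 1\<close> and \<open>a - 1\<close> is four times
        \<open>a\<close>, so a Jordan ideal is an ordinary ideal.\<close>
      have "(a + 1) * (a + 1) * x + scaleC (- 1) ((a - 1) * (a - 1) * x) \<in> K"
        using sub x by blast
      moreover have "(a + 1) * (a + 1) * x + scaleC (- 1) ((a - 1) * (a - 1) * x) = scaleC 4 (a * x)"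
      proof -
        have "scaleC 4 (a * x) = 4 *\<^sub>R (a * x)" using scaleC_of_real[of 4 "a * x"] by simp
        also have "\<dots> = a * x + a * x + a * x + a * x"
          by (simp add: scaleR_left_distrib[of 2 2, simplified] scaleR_2)
        finally show ?thesis by (simp add: scaleC_minus_left algebra_simps)
      qed
      ultimately have "scaleC (1/4) (scaleC 4 (a * x)) \<in> K" using sub by metis
      then show ?thesis by (simp add: scaleC_scaleC)
    qed
    moreover have "1 - x dvd 1" if "x \<in> K" for x
      using K that by (auto simp: quasi_invertible_def invertibles_commutative)
    ultimately show "K \<subseteq> J"
      using quasi_invertible_ideal_character[of K] unfolding J_def by blast
  qed
  then have "J = {0}" using ss by (simp add: semisimple_def)
  then show ?thesis using x by (auto simp: J_def)
qed

section \<open>A Gleason--Kahane--Zelazko theorem for Jordan algebras\<close>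

text \<open>Both sides are homogeneous in the polynomial, so that no normalisation of the constant
  coefficient is needed; for constant coefficient 1 this is Newton's identity for the sum of the
  squares of the reciprocals of the roots.\<close>

lemma newton_second_reciprocal:
  fixes A :: "complex multiset"
  assumes "0 \<notin># A"
  defines "Q \<equiv> (\<Prod>x\<in>#A. [:- x, 1:])"
  shows "(coeff Q 1)\<^sup>2 - 2 * coeff Q 0 * coeff Q 2 = (coeff Q 0)\<^sup>2 * (\<Sum>x\<in>#A. (inverse x)\<^sup>2)"
  using assms(1) unfolding Q_def
proof (induction A)
  case (add x A)
  let ?Q = "\<Prod>x\<in>#A. [:- x, 1:]"
  have x: "x \<noteq> 0" using add by auto
  have c: "coeff ([:- x, 1:] * ?Q) 0 = - x * coeff ?Q 0"
    "coeff ([:- x, 1:] * ?Q) 1 = coeff ?Q 0 - x * coeff ?Q 1"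
    "coeff ([:- x, 1:] * ?Q) 2 = coeff ?Q 1 - x * coeff ?Q 2"
    by (simp_all add: coeff_pCons numeral_2_eq_2)
  have "(coeff ?Q 0 - x * coeff ?Q 1)\<^sup>2 - 2 * (- x * coeff ?Q 0) * (coeff ?Q 1 - x * coeff ?Q 2)
    = (coeff ?Q 0)\<^sup>2 + x\<^sup>2 * ((coeff ?Q 1)\<^sup>2 - 2 * coeff ?Q 0 * coeff ?Q 2)"
    by (simp add: power2_eq_square algebra_simps)
  also have "\<dots> = (coeff ?Q 0)\<^sup>2 + x\<^sup>2 * ((coeff ?Q 0)\<^sup>2 * (\<Sum>x\<in>#A. (inverse x)\<^sup>2))"
    using add by simp
  also have "\<dots> = (- x * coeff ?Q 0)\<^sup>2 * (\<Sum>x\<in>#add_mset x A. (inverse x)\<^sup>2)"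
    using x by (simp add: power_mult_distrib field_simps)
  finally show ?case unfolding c[symmetric] by simp
qed simp

text \<open>The left side is a sum of squares of reciprocal roots, one for each root with
  multiplicity. The hypothesis on roots avoids division, so that \<open>M = 0\<close> is no special
  case.\<close>

lemma newton_second_bound:
  fixes p :: "complex poly" and M :: real
  assumes p0: "coeff p 0 = 1" and roots: "\<And>z. poly p z = 0 \<Longrightarrow> 1 \<le> M * cmod z"
  shows "cmod ((coeff p 1)\<^sup>2 - 2 * coeff p 2) \<le> degree p * M\<^sup>2"
proof -
  have "p \<noteq> 0" using p0 by auto
  then obtain A where A: "size A = degree p" "p = smult (lead_coeff p) (\<Prod>x\<in>#A. [:-x, 1:])"
    using alg_closed_imp_factorization by blast
  define Q where "Q = (\<Prod>x\<in>#A. [:-x, 1:])"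
  define l where "l = lead_coeff p"
  have p: "p = smult l Q" using A by (simp add: Q_def l_def)
  have root: "poly p x = 0" if "x \<in># A" for x
    unfolding p Q_def using that by (auto simp: poly_prod_mset prod_mset_zero_iff)
  have "0 \<notin># A" using root[of 0] p0 by (auto simp: poly_0_coeff_0)
  from newton_second_reciprocal[OF this]
  have "l\<^sup>2 * ((coeff Q 1)\<^sup>2 - 2 * coeff Q 0 * coeff Q 2)
      = l\<^sup>2 * ((coeff Q 0)\<^sup>2 * (\<Sum>x\<in>#A. (inverse x)\<^sup>2))"
    by (simp add: Q_def)
  then have "(coeff p 1)\<^sup>2 - 2 * coeff p 0 * coeff p 2 = (coeff p 0)\<^sup>2 * (\<Sum>x\<in>#A. (inverse x)\<^sup>2)"
    unfolding p by (simp add: power2_eq_square algebra_simps)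
  then have eq: "(coeff p 1)\<^sup>2 - 2 * coeff p 2 = (\<Sum>x\<in>#A. (inverse x)\<^sup>2)" by (simp add: p0)
  \<comment> \<open>The induction runs over submultisets of \<open>A\<close>, whose elements are
    still known to be roots.\<close>
  have "cmod (\<Sum>x\<in>#B. (inverse x)\<^sup>2) \<le> size B * M\<^sup>2" if "B \<subseteq># A" for B
    using that
  proof (induction B)
    case (add x B)
    have xB: "x \<in># A" "B \<subseteq># A"
      using mset_subset_eq_insertD[OF add.prems] by (auto simp: subset_mset.less_imp_le)
    then have x: "1 \<le> M * cmod x" using root[of x] roots[of x] by simp
    then have "cmod x > 0" by (metis mult_zero_right norm_ge_zero not_one_le_zero order_less_le)
    then have "cmod (inverse x) \<le> M" using x by (simp add: norm_inverse norm_divide field_simps)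
    then have "cmod ((inverse x)\<^sup>2) \<le> M\<^sup>2" unfolding norm_power by (intro power_mono) auto
    moreover have "cmod (\<Sum>x\<in>#B. (inverse x)\<^sup>2) \<le> size B * M\<^sup>2"
      by (rule add.IH[OF xB(2)])
    ultimately show ?case
      using norm_triangle_ineq[of "(inverse x)\<^sup>2" "\<Sum>x\<in>#B. (inverse x)\<^sup>2"] by (simp add: algebra_simps)
  qed simp
  then show ?thesis unfolding eq A(1)[symmetric] by simp
qed

section \<open>Functionals that do not vanish on powers\<close>

context unital_jordan_banach_algebra
begin

lemma jpower_scaleC: "jpower jp e (scaleC c a) n = scaleC (c ^ n) (jpower jp e a n)"
  by (induction n) (auto simp: jp_scaleC_left jp_scaleC_right scaleC_scaleC mult.commute)

lemma jpower_unit_add: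
  "jpower jp e (e + x) n = (\<Sum>k\<le>n. real (n choose k) *\<^sub>R jpower jp e x k)"
proof (induction n)
  case (Suc n)
  let ?p = "jpower jp e x"
  have 1: "(\<Sum>k\<le>n. real (n choose k) *\<^sub>R ?p k) = e + (\<Sum>k\<le>n. real (n choose Suc k) *\<^sub>R ?p (Suc k))"
  proof -
    have "(\<Sum>k\<le>n. real (n choose k) *\<^sub>R ?p k) = (\<Sum>k\<le>Suc n. real (n choose k) *\<^sub>R ?p k)"
      by simp
    then show ?thesis by (simp only: sum.atMost_Suc_shift) simp
  qed
  have "jpower jp e (e + x) (Suc n)
      = (\<Sum>k\<le>n. real (n choose k) *\<^sub>R ?p k) + (\<Sum>k\<le>n. real (n choose k) *\<^sub>R ?p (Suc k))"
    by (simp add: Suc jp_add_left jp_unit scaleR_add_right sum.distrib bounded_bilinear.sum_right[OF bounded_bilinear_jp] jp_scaleR_right)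
  also have "\<dots> = e + (\<Sum>k\<le>n. real (Suc n choose Suc k) *\<^sub>R ?p (Suc k))"
    unfolding 1 by (simp add: scaleR_add_left sum.distrib del: jpower.simps(2))
  also have "\<dots> = (\<Sum>k\<le>Suc n. real (Suc n choose k) *\<^sub>R ?p k)"
    by (simp only: sum.atMost_Suc_shift) simp
  finally show ?case .
qed simp

text \<open>A Gleason--Kahane--Zelazko argument: the reciprocals of the roots of
  \<open>z \<mapsto> \<rho> ((e - z a)\<^sup>n)\<close> have modulus at most \<open>norm a\<close>, so the sum of their squares is \<open>O(n)\<close>; but
  it is \<open>n\<^sup>2 (\<rho> a)\<^sup>2 - n (n - 1) \<rho> (a\<^sup>2)\<close>.\<close>

lemma nonvanishing_functional_square:
  fixes \<rho> :: "'a \<Rightarrow> complex"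
  assumes add: "\<And>x y. \<rho> (x + y) = \<rho> x + \<rho> y" and scale: "\<And>c x. \<rho> (scaleC c x) = c * \<rho> x"
    and unit: "\<rho> e = 1" and nz: "\<And>a n. norm a < 1 \<Longrightarrow> \<rho> (jpower jp e (e - a) n) \<noteq> 0"
  shows "\<rho> (jp a a) = (\<rho> a)\<^sup>2"
proof -
  define M where "M = norm a"
  have sum: "\<rho> (\<Sum>k\<in>K. h k) = (\<Sum>k\<in>K. \<rho> (h k))" if "finite K" for h and K :: "nat set"
    using that by (induction K) (auto simp: add scale[of 0 0, simplified])
  have scaleR: "\<rho> (r *\<^sub>R x) = of_real r * \<rho> x" for r x
    by (metis scale scaleC_of_real)
  have b: "real n * cmod ((\<rho> a)\<^sup>2 - \<rho> (jp a a)) \<le> M\<^sup>2 + cmod (\<rho> (jp a a))" if n: "n \<ge> 2" for n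
  proof -
    define p where "p = (\<Sum>k\<le>n. monom (of_nat (n choose k) * (- 1) ^ k * \<rho> (jpower jp e a k)) k)"
    have cf: "coeff p k = of_nat (n choose k) * (- 1) ^ k * \<rho> (jpower jp e a k)" if "k \<le> n" for k
      using that by (simp add: p_def coeff_sum sum.delta' if_distrib cong: if_cong)
    have deg: "degree p \<le> n"
      unfolding p_def by (intro degree_sum_le) (auto intro: order_trans[OF degree_monom_le])
    have pp: "poly p z = \<rho> (jpower jp e (e - scaleC z a) n)" for z
    proof -
      have "jpower jp e (e - scaleC z a) n = jpower jp e (e + scaleC (- z) a) n"
        by (simp add: scaleC_minus_left)
      then show ?thesis
        by (simp add: p_def poly_sum poly_monom jpower_unit_add sum scaleR jpower_scaleC scale
            power_minus[of z] mult_ac)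
    qed
    have "cmod ((coeff p 1)\<^sup>2 - 2 * coeff p 2) \<le> degree p * M\<^sup>2"
    proof (rule newton_second_bound)
      show "coeff p 0 = 1" using cf[of 0] by (simp add: unit)
      fix z assume "poly p z = 0"
      then have "\<not> norm (scaleC z a) < 1" using nz pp by metis
      then show "1 \<le> M * cmod z" by (simp add: norm_scaleC M_def mult.commute)
    qed
    also have "\<dots> \<le> n * M\<^sup>2" using deg by (intro mult_right_mono) auto
    finally have 1: "cmod ((coeff p 1)\<^sup>2 - 2 * coeff p 2) \<le> n * M\<^sup>2" .
    have "2 * of_nat (n choose 2) = (of_nat n * (of_nat n - 1) :: complex)"
    proof -
      have "even (n * (n - 1))" by (cases n) auto
      then have "2 * (n choose 2) = n * (n - 1)" by (simp add: choose_two)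
      then have "of_nat (2 * (n choose 2)) = (of_nat (n * (n - 1)) :: complex)" by simp
      then show ?thesis using n by (simp add: of_nat_diff)
    qed
    then have 2: "2 * coeff p 2 = of_nat n * (of_nat n - 1) * \<rho> (jp a a)"
      using cf[of 2] n by (simp add: numeral_2_eq_2 jp_unit_right)
    have 3: "coeff p 1 = - of_nat n * \<rho> a"
      using cf[of 1] n by (simp add: jp_unit_right)
    \<comment> \<open>The terms of order \<open>n\<^sup>2\<close> are collected on the left;
      everything else is of order \<open>n\<close>, so one factor \<open>n\<close> cancels and a
      bound on \<open>n\<close> times the defect remains.\<close>
    have "of_nat n * (of_nat n * ((\<rho> a)\<^sup>2 - \<rho> (jp a a)))
        = ((coeff p 1)\<^sup>2 - 2 * coeff p 2) - of_nat n * \<rho> (jp a a)"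
      unfolding 2 3 by (simp add: algebra_simps power2_eq_square)
    then have "cmod (of_nat n * (of_nat n * ((\<rho> a)\<^sup>2 - \<rho> (jp a a)))) \<le> n * M\<^sup>2 + n * cmod (\<rho> (jp a a))"
      using 1 norm_triangle_ineq4[of "(coeff p 1)\<^sup>2 - 2 * coeff p 2" "of_nat n * \<rho> (jp a a)"]
      by (simp add: norm_mult)
    then have "real n * (real n * cmod ((\<rho> a)\<^sup>2 - \<rho> (jp a a))) \<le> real n * (M\<^sup>2 + cmod (\<rho> (jp a a)))"
      by (simp add: norm_mult distrib_left)
    then show ?thesis using n by (simp add: mult_le_cancel_left)
  qed
  have "cmod ((\<rho> a)\<^sup>2 - \<rho> (jp a a)) = 0"
  proof (rule ccontr)
    assume nz: "cmod ((\<rho> a)\<^sup>2 - \<rho> (jp a a)) \<noteq> 0"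
    then obtain n where n: "M\<^sup>2 + cmod (\<rho> (jp a a)) < real n * cmod ((\<rho> a)\<^sup>2 - \<rho> (jp a a))"
      using reals_Archimedean3[of "cmod ((\<rho> a)\<^sup>2 - \<rho> (jp a a))"] by auto
    also have "\<dots> \<le> real (n + 2) * cmod ((\<rho> a)\<^sup>2 - \<rho> (jp a a))" by (intro mult_right_mono) auto
    also have "\<dots> \<le> M\<^sup>2 + cmod (\<rho> (jp a a))" by (rule b) simp
    finally show False by simp
  qed
  then show ?thesis by simp
qed

lemma continuous_on_jpower:
  "continuous_on S f \<Longrightarrow> continuous_on S (\<lambda>t. jpower jp e (f t) n)"
  by (induction n) (auto intro: bounded_bilinear.continuous_on[OF bounded_bilinear_jp])

text \<open>Write \<open>\<theta>\<close> as \<open>\<psi> + cnj \<circ> \<kappa>\<close> with complex linear \<open>\<psi>\<close> and \<open>\<kappa>\<close>. As \<open>\<theta>\<close> does not vanish on complex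
  multiples, \<open>\<kappa>\<close> is dominated by \<open>\<psi>\<close> on the elements \<open>(e - a)\<^sup>n\<close>, so \<open>\<psi> + u \<kappa>\<close> falls under the
  previous lemma whenever \<open>cmod u \<le> 1\<close>; comparing \<open>u = 0, 1, -1\<close> yields \<open>\<kappa> = 0\<close>.\<close>

lemma real_functional_multiplicative:
  fixes \<theta> :: "'a \<Rightarrow> complex"
  assumes lin: "bounded_linear \<theta>" and unit: "\<And>c. \<theta> (scaleC c e) = c"
    and pow: "\<And>b n. b \<in> unit_balls \<Longrightarrow> jpower jp e b n \<in> M"
    and scale: "\<And>b c. b \<in> M \<Longrightarrow> c \<noteq> 0 \<Longrightarrow> scaleC c b \<in> M"
    and nz: "\<And>b. b \<in> M \<Longrightarrow> \<theta> b \<noteq> 0"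
  shows "\<theta> (jp x y) = \<theta> x * \<theta> y"
proof -
  interpret \<theta>: bounded_linear \<theta> by (rule lin)
  define \<psi> where "\<psi> x = (\<theta> x - \<i> * \<theta> (scaleC \<i> x)) / 2" for x
  define \<kappa> where "\<kappa> x = cnj ((\<theta> x + \<i> * \<theta> (scaleC \<i> x)) / 2)" for x
  have split: "\<theta> x = \<psi> x + cnj (\<kappa> x)" for x by (simp add: \<psi>_def \<kappa>_def field_simps)
  have dec: "scaleC c x = Re c *\<^sub>R x + Im c *\<^sub>R scaleC \<i> x" for c x
    by (metis complex_eq mult.commute scaleC_add_left scaleC_of_real scaleC_scaleC)
  have ii: "scaleC \<i> (scaleC \<i> x) = - x" for x by (simp add: scaleC_scaleC scaleC_minus_left)
  have \<psi>_add: "\<psi> (x + y) = \<psi> x + \<psi> y" and \<kappa>_add: "\<kappa> (x + y) = \<kappa> x + \<kappa> y" for x y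
    by (simp_all add: \<psi>_def \<kappa>_def \<theta>.add scaleC_add_right field_simps)
  have \<psi>_scale: "\<psi> (scaleC c x) = c * \<psi> x" for c x
  proof -
    have "\<psi> (a *\<^sub>R x + b *\<^sub>R scaleC \<i> x) = (of_real a + \<i> * of_real b) * \<psi> x" for a b
      by (simp add: \<psi>_def \<theta>.add \<theta>.scaleR \<theta>.neg \<theta>.diff scaleC_add_right scaleC_diff_right
          scaleC_scaleR_commute ii scaleR_conv_of_real field_simps)
    then show ?thesis by (subst dec) (simp flip: complex_eq)
  qed
  have \<kappa>_scale: "\<kappa> (scaleC c x) = c * \<kappa> x" for c x
  proof -
    have "\<kappa> (a *\<^sub>R x + b *\<^sub>R scaleC \<i> x) = (of_real a + \<i> * of_real b) * \<kappa> x" for a b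
      by (simp add: \<kappa>_def \<theta>.add \<theta>.scaleR \<theta>.neg \<theta>.diff scaleC_add_right scaleC_diff_right
          scaleC_scaleR_commute ii scaleR_conv_of_real field_simps)
    then show ?thesis by (subst dec) (simp flip: complex_eq)
  qed
  have \<psi>e: "\<psi> e = 1" and \<kappa>e: "\<kappa> e = 0"
    using unit[of 1] unit[of \<i>] by (simp_all add: \<psi>_def \<kappa>_def)
  have ne: "cmod (\<psi> b) \<noteq> cmod (\<kappa> b)" if b: "b \<in> M" for b
  proof
    assume eq: "cmod (\<psi> b) = cmod (\<kappa> b)"
    \<comment> \<open>This \<open>s\<close> solves
      \<open>s * \<psi> b + cnj s * cnj (\<kappa> b) = 0\<close>, which says that
      \<open>\<theta>\<close> vanishes at \<open>scaleC s b\<close>: multiply by \<open>s\<close>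
      and use that \<open>s * cnj s\<close> is the square of the common modulus.\<close>
    define s where "s = csqrt (- (cnj (\<kappa> b) * cnj (\<psi> b)))"
    show False
    proof (cases "\<psi> b = 0")
      case True
      then show False using eq nz[OF b] by (simp add: split)
    next
      case False
      have s2: "s * s = - (cnj (\<kappa> b) * cnj (\<psi> b))"
        by (simp add: s_def flip: power2_eq_square)
      then have s0: "s \<noteq> 0" using False eq by auto
      have "cmod s * cmod s = cmod (\<psi> b) * cmod (\<psi> b)"
        using arg_cong[OF s2, of cmod] eq by (simp add: norm_mult)
      then have ss: "s * cnj s = \<psi> b * cnj (\<psi> b)"
        by (metis complex_norm_square of_real_mult power2_eq_square)
      have "s * \<theta> (scaleC s b) = (s * s) * \<psi> b + (s * cnj s) * cnj (\<kappa> b)"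
        by (simp add: split \<psi>_scale \<kappa>_scale algebra_simps)
      also have "\<dots> = 0" unfolding s2 ss by (simp add: algebra_simps)
      finally show False using s0 nz[OF scale[OF b s0]] by simp
    qed
  qed
  have lt: "cmod (\<kappa> (jpower jp e (e - a) n)) < cmod (\<psi> (jpower jp e (e - a) n))"
    if a: "norm a < 1" for a n
  proof (rule ccontr)
    \<comment> \<open>On the segment from \<open>e\<close> to \<open>e - a\<close> the two moduli
      start at 1 and 0 and can never be equal, so the intermediate value theorem preserves their
      order.\<close>
    define h where "h t = cmod (\<psi> (jpower jp e (e - t *\<^sub>R a) n)) - cmod (\<kappa> (jpower jp e (e - t *\<^sub>R a) n))"
      for t
    assume "\<not> ?thesis"
    then have h1: "h 1 \<le> 0" by (simp add: h_def)
    have "jpower jp e e n = e" by (induction n) (auto simp: jp_unit)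
    then have h0: "0 \<le> h 0" by (simp add: h_def \<psi>e \<kappa>e)
    have "continuous_on {0..1} h"
      unfolding h_def \<psi>_def \<kappa>_def
      by (intro continuous_intros \<theta>.continuous_on continuous_on_jpower
          bounded_bilinear.continuous_on[OF bounded_bilinear_scaleC]) auto
    then obtain t where t: "0 \<le> t" "t \<le> 1" "h t = 0"
      using IVT2'[of h 1 0 0] h0 h1 by auto
    have "norm (- t *\<^sub>R a) < cmod 1"
      using a t mult_left_le_one_le[of "norm a" t] by simp
    then have "scaleC 1 e + (- t *\<^sub>R a) \<in> unit_balls" by (rule unit_balls_add)
    then have "jpower jp e (e - t *\<^sub>R a) n \<in> M" by (intro pow) simp
    then show False using ne t(3) by (auto simp: h_def)
  qed
  have mult: "\<psi> (jp a a) + u * \<kappa> (jp a a) = (\<psi> a + u * \<kappa> a)\<^sup>2" if u: "cmod u \<le> 1" for u a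
  proof (rule nonvanishing_functional_square)
    fix a :: 'a and n assume a: "norm a < 1"
    let ?b = "jpower jp e (e - a) n"
    have "cmod (u * \<kappa> ?b) \<le> cmod (\<kappa> ?b)"
      using u by (simp add: norm_mult mult_left_le_one_le)
    also have "\<dots> < cmod (\<psi> ?b)" by (rule lt[OF a])
    finally show "\<psi> ?b + u * \<kappa> ?b \<noteq> 0"
      by (metis add_eq_0_iff norm_minus_cancel order_less_irrefl)
  qed (simp_all add: \<psi>_add \<kappa>_add \<psi>_scale \<kappa>_scale \<psi>e \<kappa>e algebra_simps)
  have \<kappa>0: "\<kappa> a = 0" for a
  proof -
    have "2 * (\<psi> a)\<^sup>2 = 2 * (\<psi> a)\<^sup>2 + 2 * (\<kappa> a)\<^sup>2"
      using mult[of 0 a] mult[of 1 a] mult[of "- 1" a] by (simp add: power2_eq_square algebra_simps)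
    then show ?thesis by simp
  qed
  have sq: "\<theta> (jp a a) = (\<theta> a)\<^sup>2" for a using mult[of 0 a] by (simp add: split \<kappa>0)
  have "\<theta> (jp (x + y) (x + y)) = \<theta> (jp x x) + 2 * \<theta> (jp x y) + \<theta> (jp y y)"
    by (simp add: jp_add_left jp_add_right \<theta>.add jp_commute[of y x])
  then show ?thesis by (simp add: sq \<theta>.add power2_eq_square algebra_simps)
qed

end

section \<open>Isometries between sets of invertible elements\<close>

lemma open_units: "open {a::'a::{complex_banach_algebra_1, comm_ring_1}. a dvd 1}"
  unfolding open_contains_ball
proof
  fix a :: 'a assume "a \<in> {a. a dvd 1}"
  then obtain b where b: "a * b = 1" by (auto simp: dvd_def)
  then have b0: "norm b > 0" by auto
  have "x dvd 1" if x: "dist a x < 1 / norm b" for x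
  proof -
    have "1 - x * b = (a - x) * b" by (simp add: algebra_simps b)
    then have "norm (1 - x * b) \<le> dist a x * norm b"
      using norm_mult_ineq[of "a - x" b] by (simp add: dist_norm)
    also have "\<dots> < 1" using x b0 by (simp add: field_simps)
    finally have "1 - (1 - x * b) \<in> invertibles special_jp 1"
      by (rule unital_jordan_banach_algebra.neumann_invertible[OF unital_jordan_banach_algebra_special])
    then show "x dvd 1" by (auto simp: invertibles_commutative elim: dvd_mult_left)
  qed
  then show "\<exists>r>0. ball a r \<subseteq> {a. a dvd 1}"
    using b0 by (intro exI[of _ "1 / norm b"]) auto
qed

text \<open>Here \<open>f\<close> stands for the inverse of the given isometry and \<open>M\<close>
  for the clopen quadratic subset of \<open>N\<close>; the assumptions collect what the closure
  properties of both subsets supply.\<close>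

locale unit_isometry = unital_jordan_banach_algebra jp e
  for jp :: "'n::complex_banach \<Rightarrow> 'n \<Rightarrow> 'n" and e +
  fixes M :: "'n set" and f :: "'n \<Rightarrow> 'a::{complex_banach_algebra_1, comm_ring_1}"
  assumes semisimple_codomain: "semisimple special_jp (1::'a)"
    and unit_balls_M: "unit_balls \<subseteq> M"
    and scaleC_M: "\<And>b c. b \<in> M \<Longrightarrow> c \<noteq> 0 \<Longrightarrow> scaleC c b \<in> M"
    and jpower_M: "\<And>b n. b \<in> M \<Longrightarrow> jpower jp e b n \<in> M"
    and unit_image: "\<And>b. b \<in> M \<Longrightarrow> f b dvd 1"
    and isometry: "\<And>b c. b \<in> M \<Longrightarrow> c \<in> M \<Longrightarrow> dist (f b) (f c) = dist b c"
    and open_image: "open (f ` M)"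
begin

lemma real_linear_extension:
  obtains S where "linear S" "surj S" "\<And>x. norm (S x) = norm x" "\<And>b. b \<in> M \<Longrightarrow> f b = S b"
    "\<And>\<phi> c. is_character \<phi> \<Longrightarrow> cmod (\<phi> (S (scaleC c e))) = cmod c"
proof -
  have "inj_on f M"
    by (rule inj_onI) (metis dist_eq_0_iff isometry)
  then obtain S v where S: "linear S" "surj S" "\<And>x. norm (S x) = norm x"
      and v: "\<And>x. x \<in> unit_balls \<Longrightarrow> f x = S x + v"
    using mazur_ulam_connected[of f M "f ` M" unit_balls] isometry open_image open_unit_balls
      connected_unit_balls unit_balls_M unit_in_unit_balls by (metis empty_iff)
  interpret S: linear S by (rule S(1))
  have sg: "scaleC (of_real t) x = t *\<^sub>R x" for t and x :: 'n by (rule scaleC_of_real)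
  have nz: "\<phi> (S (scaleC c e)) + \<phi> (S x) + \<phi> v \<noteq> 0"
    if \<phi>: "is_character \<phi>" and x: "norm x < cmod c" for \<phi> c x
  proof -
    have "scaleC c e + x \<in> unit_balls" using x by (rule unit_balls_add)
    moreover from this have "f (scaleC c e + x) dvd 1" using unit_image unit_balls_M by blast
    ultimately have "\<phi> (S (scaleC c e + x) + v) \<noteq> 0"
      using character_unit_nonzero[OF \<phi>] v by metis
    then show ?thesis by (simp add: S.add is_characterD[OF \<phi>])
  qed
  have lin: "linear (\<lambda>c. \<phi> (S (scaleC c e)))" if \<phi>: "is_character \<phi>" for \<phi>
    by (rule linearI)
      (simp_all add: scaleC_add_left S.add is_characterD[OF \<phi>] S.scale
        bounded_bilinear.scaleR_left[OF bounded_bilinear_scaleC])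
  have surj: "surj (\<lambda>c. \<phi> (S (scaleC c e)))" if \<phi>: "is_character \<phi>" for \<phi>
  proof (rule linear_inj_imp_surj[OF lin[OF \<phi>]])
    show "inj (\<lambda>c. \<phi> (S (scaleC c e)))"
      unfolding linear_injective_0[OF lin[OF \<phi>]]
    \<comment> \<open>A nonzero \<open>c\<close> in the kernel can be enlarged by a real factor
      until its modulus exceeds the norm of a preimage \<open>x\<close> of
      \<open>scaleC (- \<phi> v) 1\<close>; then the sum in \<open>nz\<close> is zero.\<close>
    proof (intro allI impI, rule ccontr)
      fix c assume c: "\<phi> (S (scaleC c e)) = 0" "c \<noteq> 0"
      obtain x where x: "S x = scaleC (- \<phi> v) 1" using S(2) by (metis surjD)
      define t where "t = (norm x + 1) / cmod c"
      have "t > 0" using c by (simp add: t_def add_nonneg_pos)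
      then have "cmod (t *\<^sub>R c) = norm x + 1" using c by (simp add: t_def)
      moreover have "\<phi> (S (scaleC (t *\<^sub>R c) e)) = 0"
        using linear_scale[OF lin[OF \<phi>], of t c] c by simp
      moreover have "\<phi> (S x) = - \<phi> v" by (simp add: x is_characterD[OF \<phi>])
      ultimately show False using nz[OF \<phi>, of x "t *\<^sub>R c"] by simp
    qed
  qed
  have "v = 0"
  proof (rule semisimple_character[OF semisimple_codomain])
    fix \<phi> :: "'a \<Rightarrow> complex" assume \<phi>: "is_character \<phi>"
    obtain c where c: "\<phi> (S (scaleC c e)) = - \<phi> v" using surjD[OF surj[OF \<phi>]] by metis
    have "c = 0" using nz[OF \<phi>, of 0 c] c by (auto simp: S.zero is_characterD[OF \<phi>])
    then show "\<phi> v = 0" using c by (simp add: S.zero is_characterD[OF \<phi>])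
  qed
  have R: "cmod (\<phi> (S (scaleC c e))) = cmod c" if \<phi>: "is_character \<phi>" for \<phi> c
  proof (rule antisym)
    show "cmod (\<phi> (S (scaleC c e))) \<le> cmod c"
      using is_characterD(5)[OF \<phi>, of "S (scaleC c e)"] by (simp add: S(3) norm_scaleC norm_unit)
    show "cmod c \<le> cmod (\<phi> (S (scaleC c e)))"
    proof (rule ccontr)
      assume lt: "\<not> ?thesis"
      \<comment> \<open>This \<open>x\<close> has norm below \<open>cmod c\<close> and cancels the
        value at \<open>scaleC c e\<close>, against \<open>nz\<close>.\<close>
      obtain x where x: "S x = scaleC (- \<phi> (S (scaleC c e))) 1" using S(2) by (metis surjD)
      have "norm x = cmod (\<phi> (S (scaleC c e)))"
        using S(3)[of x] by (simp add: x norm_scaleC)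
      moreover have "\<phi> (S x) = - \<phi> (S (scaleC c e))" by (simp add: x is_characterD[OF \<phi>])
      ultimately show False
        using nz[OF \<phi>, of x c] lt by (simp add: \<open>v = 0\<close> is_characterD[OF \<phi>])
    qed
  qed
  have "f b = S b" if b: "b \<in> M" for b
  proof -
    obtain c0 where c0: "S c0 = f b" using S(2) by (metis surjD)
    have "S (b - c0) = 0"
    proof (rule semisimple_character[OF semisimple_codomain], rule ccontr)
      fix \<phi> :: "'a \<Rightarrow> complex" assume \<phi>: "is_character \<phi>" and z: "\<phi> (S (b - c0)) \<noteq> 0"
      define z where "z = \<phi> (S (b - c0))"
      \<comment> \<open>Choose \<open>l\<close> so that \<open>\<phi> (S (scaleC l e))\<close>
        points in the direction of the defect \<open>z\<close>. Then
        \<open>x = scaleC l e + b\<close> lies in the balls, and the isometry gives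
        \<open>norm (x - c0) = cmod l\<close>; but \<open>\<phi>\<close> sees the larger value
        \<open>cmod l + cmod z\<close>.\<close>
      obtain l where l: "\<phi> (S (scaleC l e)) = (norm b + 1) *\<^sub>R sgn z"
        using surjD[OF surj[OF \<phi>]] by metis
      have "cmod l = norm b + 1" using R[OF \<phi>, of l] z by (simp add: l z_def norm_sgn)
      define x where "x = scaleC l e + b"
      have x: "x \<in> unit_balls" unfolding x_def by (rule unit_balls_add) (simp add: \<open>cmod l = _\<close>)
      have "norm (x - c0) = dist (f x) (f b)"
        using v[OF x] S(3)[of "x - c0"] by (simp add: \<open>v = 0\<close> S.diff c0 dist_norm)
      also have "\<dots> = norm (scaleC l e)"
        using isometry[of x b] x b unit_balls_M by (auto simp: x_def dist_norm)
      finally have "norm (S (x - c0)) = norm b + 1"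
        by (simp add: S(3) norm_scaleC norm_unit \<open>cmod l = _\<close>)
      moreover have "\<phi> (S (x - c0)) = (norm b + 1) *\<^sub>R sgn z + z"
        using l by (simp add: x_def z_def S.add S.diff is_characterD[OF \<phi>])
      moreover have "(norm b + 1) *\<^sub>R sgn z + z = (norm b + 1 + cmod z) *\<^sub>R sgn z"
      proof -
        have "cmod z *\<^sub>R sgn z = z" by (cases "z = 0") (simp_all add: sgn_div_norm)
        then show ?thesis by (simp add: scaleR_add_left)
      qed
      moreover have "cmod (\<phi> (S (x - c0))) \<le> norm (S (x - c0))" by (rule is_characterD[OF \<phi>])
      ultimately show False using z by (simp add: norm_sgn z_def)
    qed
    then have "b - c0 = 0" using S(3)[of "b - c0"] by simp
    then show ?thesis using c0 by simp
  qed
  then show ?thesis using that S R by blast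
qed

text \<open>It suffices to test the identity with characters. For each \<open>\<phi>\<close> the map
  \<open>c \<mapsto> \<theta> (scaleC c e)\<close> is a real linear isometry of the plane fixing 1,
  hence the identity or conjugation, and the functional theorem applies to \<open>\<theta>\<close>
  or to its conjugate.\<close>

lemma weighted_multiplicative_extension:
  obtains S where "linear S" "surj S" "\<And>x. norm (S x) = norm x" "\<And>b. b \<in> M \<Longrightarrow> f b = S b"
    "\<And>x y. S e * S (jp x y) = S x * S y"
proof -
  obtain S where S: "linear S" "surj S" "\<And>x. norm (S x) = norm x" "\<And>b. b \<in> M \<Longrightarrow> f b = S b"
    and R: "\<And>\<phi> c. is_character \<phi> \<Longrightarrow> cmod (\<phi> (S (scaleC c e))) = cmod c"
    using real_linear_extension by blast
  interpret S: linear S by (rule S(1))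
  have "S e * S (jp x y) - S x * S y = 0" for x y
  proof (rule semisimple_character[OF semisimple_codomain])
    fix \<phi> :: "'a \<Rightarrow> complex" assume \<phi>: "is_character \<phi>"
    define w where "w = \<phi> (S e)"
    define \<theta> where "\<theta> x = \<phi> (S x) / w" for x
    have w: "cmod w = 1" using R[OF \<phi>, of 1] by (simp add: w_def)
    then have w0: "w \<noteq> 0" by auto
    have lin: "bounded_linear \<theta>"
    proof (rule bounded_linear_intro[of _ 1])
      show "cmod (\<theta> x) \<le> norm x * 1" for x
        using is_characterD(5)[OF \<phi>, of "S x"] by (simp add: \<theta>_def norm_divide w S(3))
    qed (simp_all add: \<theta>_def S.add S.scale is_characterD[OF \<phi>] add_divide_distrib scaleR_conv_of_real[where 'a = complex])
    interpret \<theta>: bounded_linear \<theta> by (rule lin)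
    define q where "q = \<theta> (scaleC \<i> e)"
    have dec: "scaleC c e = Re c *\<^sub>R e + Im c *\<^sub>R scaleC \<i> e" for c
      by (metis complex_eq mult.commute scaleC_add_left scaleC_of_real scaleC_scaleC)
    have \<theta>e: "\<theta> e = 1" using w0 by (simp add: \<theta>_def w_def)
    have \<theta>c: "\<theta> (scaleC c e) = of_real (Re c) + of_real (Im c) * q" for c
      by (subst dec) (simp add: \<theta>.add \<theta>.scaleR \<theta>e q_def scaleR_conv_of_real)
    have norm\<theta>: "cmod (\<theta> (scaleC c e)) = cmod c" for c
      by (simp add: \<theta>_def norm_divide w R[OF \<phi>])
    \<comment> \<open>The moduli of \<open>q\<close> and \<open>1 + q\<close> are those of
      \<open>\<i>\<close> and \<open>1 + \<i>\<close>, which forces \<open>Re q = 0\<close>.\<close>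
    have q: "q = \<i> \<or> q = - \<i>"
    proof -
      have "cmod q = 1" "cmod (1 + q) = cmod (1 + \<i>)"
        using norm\<theta>[of \<i>] norm\<theta>[of "1 + \<i>"] \<theta>c[of \<i>] \<theta>c[of "1 + \<i>"] by simp_all
      then have "(Re q)\<^sup>2 + (Im q)\<^sup>2 = 1" "(1 + Re q)\<^sup>2 + (Im q)\<^sup>2 = 2"
        by (simp_all add: cmod_def)
      then have "Re q = 0" by (simp add: power2_eq_square algebra_simps)
      then have "Im q = 1 \<or> Im q = - 1"
        using \<open>(Re q)\<^sup>2 + (Im q)\<^sup>2 = 1\<close> by (simp add: power2_eq_1_iff)
      then show ?thesis using \<open>Re q = 0\<close> by (auto simp: complex_eq_iff)
    qed
    have nz: "\<theta> b \<noteq> 0" if "b \<in> M" for b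
      using character_unit_nonzero[OF \<phi> unit_image[OF that]] S(4)[OF that] w0 by (simp add: \<theta>_def)
    have pow: "jpower jp e b n \<in> M" if "b \<in> unit_balls" for b n
      using jpower_M that unit_balls_M by auto
    have "\<theta> (jp x y) = \<theta> x * \<theta> y"
      using q
    proof
      assume "q = \<i>"
      show ?thesis
      proof (rule real_functional_multiplicative[of \<theta> M, OF lin _ pow scaleC_M nz])
        show "\<theta> (scaleC c e) = c" for c
          by (simp add: \<theta>c \<open>q = \<i>\<close> mult.commute[of _ \<i>] flip: complex_eq)
      qed
    next
      assume q: "q = - \<i>"
      have "cnj (\<theta> (jp x y)) = cnj (\<theta> x) * cnj (\<theta> y)"
      proof (rule real_functional_multiplicative[of "\<lambda>x. cnj (\<theta> x)" M, OF _ _ pow scaleC_M])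
        show "bounded_linear (\<lambda>x. cnj (\<theta> x))"
          using bounded_linear_compose[OF bounded_linear_cnj lin] .
        show "cnj (\<theta> (scaleC c e)) = c" for c
          by (simp add: \<theta>c q mult.commute[of _ \<i>] flip: complex_eq)
        show "cnj (\<theta> b) \<noteq> 0" if "b \<in> M" for b using nz that by simp
      qed
      then show ?thesis by (metis complex_cnj_cnj complex_cnj_mult)
    qed
    then have "w * \<phi> (S (jp x y)) = \<phi> (S x) * \<phi> (S y)"
      using w0 by (simp add: \<theta>_def field_simps)
    then show "\<phi> (S e * S (jp x y) - S x * S y) = 0"
      by (simp add: is_characterD[OF \<phi>] w_def)
  qed
  then show ?thesis using that[OF S(1,2,3,4)] by simp
qed

end

section \<open>Transfer along the isomorphism\<close>

context unital_jordan_banach_algebra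
begin

lemma invertibles_isomorphic_image:
  fixes T :: "'b::{complex_banach_algebra_1, comm_ring_1} \<Rightarrow> 'a"
  assumes surj: "surj T" and inj: "inj T" and mult: "\<And>x y. T (x * y) = jp (T x) (T y)" and one: "T 1 = e"
  shows "invertibles jp e = T ` {a. a dvd 1}"
proof (intro equalityI subsetI)
  fix y assume "y \<in> invertibles jp e"
  then obtain z where "jp y z = e" by (auto simp: invertibles_def is_jinverse_def)
  moreover obtain a b where "y = T a" "z = T b" using surj by (metis surjD)
  ultimately have "T (a * b) = T 1" by (simp add: mult one)
  then have "a dvd 1" using inj by (metis dvdI injD)
  then show "y \<in> T ` {a. a dvd 1}" using \<open>y = T a\<close> by auto
next
  fix y assume "y \<in> T ` {a. a dvd 1}"
  then obtain a b where ab: "y = T a" "1 = a * b" by (auto simp: dvd_def)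
  have "is_jinverse jp e (T a) (T b)"
    unfolding is_jinverse_def mult[symmetric] using ab(2) by (simp add: mult.assoc flip: one)
  then show "y \<in> invertibles jp e" using ab by (auto simp: invertibles_def)
qed

text \<open>As \<open>T\<close> is only real linear, the preimage \<open>K'\<close> of an ideal is
  at first only a real subspace. Polarising squares makes it closed under multiplication by the
  whole algebra, complex multiples of 1 included, and this is enough for characters to vanish on
  it.\<close>

lemma semisimple_isomorphic_image:
  fixes T :: "'b::{complex_banach_algebra_1, comm_ring_1} \<Rightarrow> 'a"
  assumes ss: "semisimple special_jp (1::'b)" and lin: "linear T" and bij: "bij T"
    and mult: "\<And>x y. T (x * y) = jp (T x) (T y)" and one: "T 1 = e"
  shows "semisimple jp e"
proof -
  interpret T: linear T by (rule lin)
  have inj: "inj T" and surj: "surj T" using bij by (auto simp: bij_def)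
  have inv: "invertibles jp e = T ` {a. a dvd 1}"
    by (rule invertibles_isomorphic_image[OF surj inj mult one])
  have trivial: "K \<subseteq> {0}"
    if K: "jordan_ideal jp K" and qi: "\<forall>x\<in>K. quasi_invertible jp e x" for K
  proof
    fix y assume y: "y \<in> K"
    obtain x where x: "y = T x" using surj by (metis surjD)
    define K' where "K' = {a. T a \<in> K}"
    have sub: "r *\<^sub>R z \<in> K'" "z + z' \<in> K'" "a * a * z \<in> K'" if "z \<in> K'" "z' \<in> K'" for r z z' a
    proof -
      have "scaleC (of_real r) (T z) \<in> K" "T z + T z' \<in> K" "U_op jp (T a) (T z) \<in> K"
        using K that by (simp_all add: K'_def jordan_ideal_def complex_subspace_def)
      moreover have "U_op jp (T a) (T z) = T (a * a * z)"
      proof -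
        have "U_op jp (T a) (T z) = T (2 *\<^sub>R (a * z * a) - a * a * z)"
          by (simp add: U_op_def T.diff T.scale flip: mult)
        also have "2 *\<^sub>R (a * z * a) - a * a * z = a * a * z"
          by (simp add: scaleR_2 mult_ac)
        finally show ?thesis .
      qed
      ultimately show "r *\<^sub>R z \<in> K'" "z + z' \<in> K'" "a * a * z \<in> K'"
        by (simp_all add: K'_def scaleC_of_real T.scale T.add)
    qed
    have "a * z \<in> K'" if z: "z \<in> K'" for a z
    proof -
      have sq: "b * b * z \<in> K'" for b by (rule sub(3)[OF z z])
      have sum: "(a + 1) * (a + 1) * z + (- 1) *\<^sub>R ((a - 1) * (a - 1) * z) \<in> K'"
        by (rule sub(2)[OF sq sub(1)[OF sq sq]])
      have "(1/4) *\<^sub>R ((a + 1) * (a + 1) * z + (- 1) *\<^sub>R ((a - 1) * (a - 1) * z)) \<in> K'"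
        by (rule sub(1)[OF sum sum])
      moreover have "(a + 1) * (a + 1) * z + (- 1) *\<^sub>R ((a - 1) * (a - 1) * z) = 4 *\<^sub>R (a * z)"
        by (simp add: algebra_simps scaleR_left_distrib[of 2 2, simplified] scaleR_2)
      ultimately show ?thesis by simp
    qed
    moreover have "1 - z dvd 1" if "z \<in> K'" for z
    proof -
      have "e - T z \<in> invertibles jp e" using qi that by (auto simp: K'_def quasi_invertible_def)
      then obtain a where "a dvd 1" "T (1 - z) = T a" by (auto simp: inv T.diff one)
      then show ?thesis using inj by (metis injD)
    qed
    ultimately have "\<phi> x = 0" if "is_character \<phi>" for \<phi>
      using quasi_invertible_ideal_character[of K' \<phi> x] that x y by (auto simp: K'_def)
    then have "x = 0" by (rule semisimple_character[OF ss])
    then show "y \<in> {0}" by (simp add: x T.zero)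
  qed
  have "mccrimmon_radical jp e = {0}"
    unfolding mccrimmon_radical_def
  proof (rule Greatest_equality)
    have "quasi_invertible jp e 0"
      using unit_balls_invertible unit_in_unit_balls by (auto simp: quasi_invertible_def)
    then show "jordan_ideal jp {0} \<and> (\<forall>x\<in>{0}. quasi_invertible jp e x)"
      by (simp add: jordan_ideal_def complex_subspace_def U_op_def jp_zero_left jp_zero_right)
  qed (use trivial in blast)
  then show ?thesis by (simp add: semisimple_def)
qed

lemma invertibles_isometric_isomorphic:
  fixes T :: "'b::{complex_banach_algebra_1, comm_ring_1} \<Rightarrow> 'a"
  assumes lin: "linear T" and bij: "bij T" and norm: "\<And>x. norm (T x) = norm x"
    and mult: "\<And>x y. T (x * y) = jp (T x) (T y)" and one: "T 1 = e"
  shows "metric_group_isometric_iso (invertibles_monoid special_jp (1::'b) (*)) (invertibles_monoid jp e jp) T"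
proof -
  let ?G = "invertibles_monoid special_jp (1::'b) (*)" and ?H = "invertibles_monoid jp e jp"
  have inj: "inj T" and surj: "surj T" using bij by (auto simp: bij_def)
  have carr: "carrier ?G = {a. a dvd 1}" "carrier ?H = T ` {a. a dvd 1}"
    by (simp_all add: invertibles_monoid_def invertibles_commutative
        invertibles_isomorphic_image[OF surj inj mult one])
  have G: "group ?G"
  proof (rule groupI)
    fix x assume "x \<in> carrier ?G"
    then obtain y where "1 = x * y" by (auto simp: carr dvd_def)
    then have "y \<in> carrier ?G" "y \<otimes>\<^bsub>?G\<^esub> x = \<one>\<^bsub>?G\<^esub>"
      by (simp_all add: carr dvd_def) (metis mult.commute, simp add: invertibles_monoid_def mult.commute)
    then show "\<exists>y\<in>carrier ?G. y \<otimes>\<^bsub>?G\<^esub> x = \<one>\<^bsub>?G\<^esub>" by blast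
  qed (auto simp: invertibles_monoid_def invertibles_commutative mult.assoc
      intro: mult_dvd_mono[where b = 1 and d = 1, simplified])
  have iso: "T \<in> iso ?G ?H"
    using inj by (auto simp: iso_def hom_def bij_betw_def carr inj_on_def)
      (auto simp: invertibles_monoid_def mult)
  have "group (?H\<lparr>one := T \<one>\<^bsub>?G\<^esub>\<rparr>)" by (rule group.iso_imp_img_group[OF G iso])
  then have "group ?H" by (simp add: invertibles_monoid_def one)
  moreover have "dist (T x) (T y) = dist x y" for x y
    using norm[of "x - y"] by (simp add: dist_norm linear_diff[OF lin])
  ultimately show ?thesis using G iso by (simp add: metric_group_isometric_iso_def)
qed

end

theorem theorem3p9:
  fixes jp :: "'n::complex_banach \<Rightarrow> 'n \<Rightarrow> 'n" and e :: 'n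
    and AA :: "'a::{complex_banach_algebra_1, comm_ring_1} set" and NN :: "'n set"
    and \<Delta> :: "'a \<Rightarrow> 'n"
  assumes A_semisimple: "semisimple special_jp (1::'a)"
    and N: "unital_jordan_banach_algebra jp e"
    and AA_quadratic: "quadratic_subset special_jp 1 AA"
    and AA_clopen: "clopen_in (invertibles special_jp 1) AA"
    and AA_closed: "closed_powers_inverses special_jp 1 AA"
    and NN_quadratic: "quadratic_subset jp e NN"
    and NN_clopen: "clopen_in (invertibles jp e) NN"
    and NN_closed: "closed_powers_inverses jp e NN"
    and \<Delta>_surj: "\<Delta> ` AA = NN"
    and \<Delta>_isometry: "\<forall>a\<in>AA. \<forall>b\<in>AA. dist (\<Delta> a) (\<Delta> b) = dist a b"
  shows "semisimple jp e
    \<and> (\<forall>x y z. jp (jp x y) z = jp x (jp y z))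
    \<and> (\<exists>T :: 'a \<Rightarrow> 'n. linear T \<and> bij T \<and> (\<forall>x y. T (x * y) = jp (T x) (T y))
          \<and> (\<forall>x. norm (T x) = norm x)
          \<and> (\<forall>a\<in>AA. T a = jp (jinverse jp e (\<Delta> 1)) (\<Delta> a)))
    \<and> (\<exists>\<Phi>. metric_group_isometric_iso
          (invertibles_monoid special_jp (1::'a) (*)) (invertibles_monoid jp e jp) \<Phi>)"
proof -
  interpret unital_jordan_banach_algebra jp e by (rule N)
  have inj: "inj_on \<Delta> AA"
    by (rule inj_onI) (metis \<Delta>_isometry dist_eq_0_iff)
  define f where "f = inv_into AA \<Delta>"
  have f: "f b \<in> AA" "\<Delta> (f b) = b" if "b \<in> NN" for b
    using that by (auto simp: f_def \<Delta>_surj[symmetric] inv_into_into f_inv_into_f)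
  have f\<Delta>: "f (\<Delta> a) = a" if "a \<in> AA" for a using that inj by (simp add: f_def)
  have e: "e \<in> NN" by (rule unit_in_quadratic_subset[OF NN_quadratic NN_closed])
  have AA_units: "AA \<subseteq> {a. a dvd 1}"
    using AA_quadratic by (auto simp: quadratic_subset_def invertibles_commutative)
  interpret unit_isometry jp e NN f
  proof
    show "semisimple special_jp (1::'a)" by (rule A_semisimple)
    show "unit_balls \<subseteq> NN" by (rule unit_balls_subset[OF NN_clopen e])
    show "scaleC c b \<in> NN" if "b \<in> NN" "c \<noteq> 0" for b c
      using scaleC_in_quadratic_subset[OF NN_quadratic NN_clopen e] that .
    show "jpower jp e b n \<in> NN" if "b \<in> NN" for b n
      using that e NN_closed by (cases "n = 0") (auto simp: closed_powers_inverses_def)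
    show "f b dvd 1" if "b \<in> NN" for b using f(1)[OF that] AA_units by auto
    show "dist (f b) (f c) = dist b c" if "b \<in> NN" "c \<in> NN" for b c
      using \<Delta>_isometry f[OF that(1)] f[OF that(2)] by metis
    have "f ` NN = AA" using f f\<Delta> \<Delta>_surj by force
    moreover have "openin (top_of_set {a. a dvd 1}) AA"
      using AA_clopen by (simp add: clopen_in_def invertibles_commutative)
    ultimately show "open (f ` NN)" using open_units openin_open_trans by blast
  qed
  obtain S where S: "linear S" "surj S" "\<And>x. norm (S x) = norm x" "\<And>b. b \<in> NN \<Longrightarrow> f b = S b"
    and S_mult: "\<And>x y. S e * S (jp x y) = S x * S y"
    using weighted_multiplicative_extension by blast
  have S_inj: "inj S"
    using S(1,3) by (metis linear_injective_0 norm_eq_zero)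
  define w where "w = S e"
  have "w dvd 1" using S(4)[OF e] f(1)[OF e] AA_units by (auto simp: w_def)
  then obtain u where u: "w * u = 1" by (metis dvdE)
  then have uw: "u * (w * a) = a" and wu: "w * (u * a) = a" for a
    by (simp_all add: mult.assoc[symmetric] mult.commute[of u w])
  \<comment> \<open>Dividing by \<open>w\<close> turns the weighted rule into multiplicativity:
    \<open>x \<mapsto> u * S x\<close> respects products, and \<open>T\<close> is its
    inverse.\<close>
  define T where "T a = inv_into UNIV S (w * a)" for a
  have ST: "S (T a) = w * a" for a using S(2) by (simp add: T_def surj_f_inv_f)
  have TS: "T (u * S x) = x" for x
    using S_inj by (simp add: T_def wu)
  have T_mult: "T (a * b) = jp (T a) (T b)" for a b
  proof -
    have "S (T (a * b)) = u * (S (T a) * S (T b))"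
      by (simp add: ST mult.assoc uw mult.left_commute[of a])
    also have "\<dots> = u * (w * S (jp (T a) (T b)))" by (simp only: S_mult w_def)
    also have "\<dots> = S (jp (T a) (T b))" by (rule uw)
    finally show ?thesis using S_inj by (rule injD[rotated])
  qed
  have T_one: "T 1 = e" using S_inj by (simp add: T_def w_def)
  have T_lin: "linear T"
  proof (rule linearI)
    show "T (a + b) = T a + T b" for a b
      using S_inj by (rule injD) (simp add: ST linear_add[OF S(1)] distrib_left)
    show "T (r *\<^sub>R a) = r *\<^sub>R T a" for r a
      using S_inj by (rule injD) (simp add: ST linear_scale[OF S(1)])
  qed
  have "surj T" by (rule surjI) (rule TS)
  moreover have "inj T"
    by (rule injI) (metis ST uw)
  ultimately have T_bij: "bij T" by (simp add: bij_def)
  have T_norm: "norm (T a) = norm a" for a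
  proof (rule antisym)
    have "norm (T a) = norm (w * a)" using S(3)[of "T a"] by (simp add: ST)
    also have "\<dots> \<le> norm w * norm a" by (rule norm_mult_ineq)
    finally show "norm (T a) \<le> norm a" by (simp add: w_def S(3) norm_unit)
    \<comment> \<open>The norm of \<open>u\<close> is not controlled directly. Its substitute in
      \<open>N\<close> is \<open>d\<close>, of norm 1: the Jordan product with \<open>d\<close>
      undoes the multiplication by \<open>w\<close>, and the norm of \<open>N\<close> is
      submultiplicative.\<close>
    obtain d where d: "S d = 1" using S(2) by (metis surjD)
    have "w * S (jp d (T a)) = w * a" using S_mult[of d "T a"] by (simp add: w_def[symmetric] d ST)
    then have "S (jp d (T a)) = a" by (metis uw)
    then have "norm a = norm (jp d (T a))" by (metis S(3))
    also have "\<dots> \<le> norm d * norm (T a)" by (rule norm_jp)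
    also have "norm d = 1" using S(3)[of d] by (simp add: d)
    finally show "norm a \<le> norm (T a)" by simp
  qed
  have T_ext: "T a = jp (jinverse jp e (\<Delta> 1)) (\<Delta> a)" if a: "a \<in> AA" for a
  proof -
    \<comment> \<open>Thus the isometry is \<open>T\<close> after multiplication by
      \<open>u\<close>, its value at 1 is \<open>T u\<close> with Jordan inverse \<open>T w\<close>,
      and the normalisation in the theorem cancels \<open>u\<close>.\<close>
    have \<Delta>: "\<Delta> b = T (u * b)" if "b \<in> AA" for b
      using TS[of "\<Delta> b"] S(4)[of "\<Delta> b"] f\<Delta>[OF that] that \<Delta>_surj by auto
    have "1 \<in> AA"
      by (rule unital_jordan_banach_algebra.unit_in_quadratic_subset
          [OF unital_jordan_banach_algebra_special AA_quadratic AA_closed])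
    then have \<Delta>1: "\<Delta> 1 = T u" by (simp add: \<Delta>)
    have "is_jinverse jp e (T u) (T w)"
      using u by (simp add: is_jinverse_def mult.assoc mult.commute[of u w] T_one flip: T_mult)
    then have "jinverse jp e (\<Delta> 1) = T w" unfolding \<Delta>1 by (rule jinverse_eq)
    then show ?thesis by (simp add: \<Delta>[OF a] wu flip: T_mult)
  qed
  have "jp (jp x y) z = jp x (jp y z)" for x y z
    using \<open>surj T\<close> by (metis surjD T_mult mult.assoc)
  moreover have "semisimple jp e"
    by (rule semisimple_isomorphic_image[OF A_semisimple T_lin T_bij T_mult T_one])
  moreover have "metric_group_isometric_iso (invertibles_monoid special_jp (1::'a) (*)) (invertibles_monoid jp e jp) T"
    by (rule invertibles_isometric_isomorphic[OF T_lin T_bij T_norm T_mult T_one])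
  ultimately show ?thesis using T_lin T_bij T_norm T_mult T_ext by blast
qed

end
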